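(* Let $w\in\{w_1,w_2,w_3,w_4\}$ be a Chebyshev weight, and let $u(x)=(1-x)^\gamma(1+x)^\delta$, $x\in[-1,1]$, be a Jacobi weight whose exponents satisfy the following bounds: - if $w=w_1$: $0\le\gamma\le 1$ and $0\le\delta\le 1$; - if $w=w_2$: $0<\gamma\le 3/2$ and $0<\delta\le 3/2$ and $-1\le\gamma-\delta\le 1$; - if $w=w_3$: $0\le\gamma\le 1$ and $0<\delta\le 3/2$ and $\gamma-\delta\le 1/2$; - if $w=w_4$: $0<\gamma\le 3/2$ and $0\le\delta\le 1$ and $\gamma-\delta\ge -1/2$. Let $C_0>1$ be a fixed constant. Then there exists a constant $\mathcal{C}>0$, independent of $n$, $m$ and $f$, such that for any pair of positive integers $n,m$ with $m<n\le C_0 m$ and for every function $f$ in the class described in the context, $$E_{n+m-1}(f)_u\le\|(f-V_n^mf)u\|\le\mathcal{C}\,E_{n-m}(f)_u .$$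
   Context: Chebyshev weights on $(-1,1)$: $w_1(x)=\frac{1}{\sqrt{1-x^2}}$, $w_2(x)=\sqrt{1-x^2}$, $w_3(x)=\sqrt{\frac{1+x}{1-x}}$, $w_4(x)=\sqrt{\frac{1-x}{1+x}}$. For $w$ one of these, $\{p_n(w,x)\}_{n\ge 0}$ is the system of orthonormal polynomials with respect to $w$ on $[-1,1]$ with positive leading coefficients ($\deg p_n=n$). The zeros of $p_n(w,\cdot)$ are $x_k=\cos t_k$, $k=1,\dots,n$, with $t_k=\frac{(2k-1)\pi}{2n}$ if $w=w_1$; $t_k=\frac{k\pi}{n+1}$ if $w=w_2$; $t_k=\frac{(2k-1)\pi}{2n+1}$ if $w=w_3$; $t_k=\frac{2k\pi}{2n+1}$ if $w=w_4$. The Christoffel numbers are $\lambda_{n,k}=\Big(\sum_{j=0}^{n}p_j(w,x_k)^2\Big)^{-1}$, $k=1,\dots,n$; that is, $\lambda_{n,k}=\frac{\pi}{n}$ if $w=w_1$; $\frac{\pi}{n+1}\sin^2 t_k$ if $w=w_2$; $\frac{4\pi}{2n+1}\cos^2\frac{t_k}{2}$ if $w=w_3$; $\frac{4\pi}{2n+1}\sin^2\frac{t_k}{2}$ if $w=w_4$. For positive integers $m<n$, the fundamental de la Vallée Poussin (VP) polynomials are $$\Phi_{n,k}^m(x)=\lambda_{n,k}\sum_{j=0}^{n+m-1}\mu_{n,j}^m\,p_j(w,x)\,p_j(w,x_k),\qquad k=1,\dots,n,$$ where $\mu_{n,j}^m=1$ if $0\le j\le n-m$ and $\mu_{n,j}^m=\frac{n+m-j}{2m}$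 if $n-m<j<n+m$. The VP polynomial of a function $f$ is $$V_n^mf(x)=\sum_{k=1}^n f(x_k)\,\Phi_{n,k}^m(x),\qquad |x|\le 1 .$$ Write $\|g\|=\sup_{|x|\le 1}|g(x)|$. The functions $f$ considered are real functions defined everywhere on $(-1,1)$, possibly unbounded at the endpoints, such that $\lim_{x\to 1}f(x)u(x)=0$ if $u(1)=0$ and $\lim_{x\to -1}f(x)u(x)=0$ if $u(-1)=0$. At an endpoint where $u$ vanishes, products such as $fu$ and $(f-P)u$ ($P$ a polynomial) are taken to be $0$; where $u(\pm1)\neq 0$, $f$ is taken to be defined at that endpoint too. Norms take values in $[0,+\infty]$. $\mathbb{P}_n$ is the set of algebraic polynomials of degree at most $n$, and the error of best weighted polynomial approximation is $$E_n(f)_u=\inf_{P\in\mathbb{P}_n}\|(f-P)u\| .$$ *)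

theory Defs
  imports "HOL-Analysis.Analysis" "HOL-Computational_Algebra.Polynomial"
begin

datatype chebyshev_kind = Cheb1 | Cheb2 | Cheb3 | Cheb4

text \<open>Only the values on the open interval \<open>(-1, 1)\<close> are meaningful.\<close>

fun cheb_weight :: "chebyshev_kind \<Rightarrow> real \<Rightarrow> real" where
  "cheb_weight Cheb1 x = 1 / sqrt (1 - x\<^sup>2)"
| "cheb_weight Cheb2 x = sqrt (1 - x\<^sup>2)"
| "cheb_weight Cheb3 x = sqrt ((1 + x) / (1 - x))"
| "cheb_weight Cheb4 x = sqrt ((1 - x) / (1 + x))"

definition orthonormal_system :: "(real \<Rightarrow> real) \<Rightarrow> (nat \<Rightarrow> real poly) \<Rightarrow> bool" where
  "orthonormal_system w p \<longleftrightarrow>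
     (\<forall>n. degree (p n) = n \<and> lead_coeff (p n) > 0) \<and>
     (\<forall>i j. ((\<lambda>x. poly (p i) x * poly (p j) x * w x) has_integral (if i = j then 1 else 0)) {-1..1})"

definition orthonormal_poly :: "(real \<Rightarrow> real) \<Rightarrow> nat \<Rightarrow> real poly" where
  "orthonormal_poly w = (THE p. orthonormal_system w p)"

abbreviation cheb_poly :: "chebyshev_kind \<Rightarrow> nat \<Rightarrow> real poly" where
  "cheb_poly c \<equiv> orthonormal_poly (cheb_weight c)"

text \<open>The points \<open>cos (cheb_angle c n k)\<close>, \<open>1 \<le> k \<le> n\<close>, are the zeros of \<open>cheb_poly c n\<close>
  in decreasing order.\<close>

fun cheb_angle :: "chebyshev_kind \<Rightarrow> nat \<Rightarrow> nat \<Rightarrow> real" where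
  "cheb_angle Cheb1 n k = (2 * real k - 1) * pi / (2 * real n)"
| "cheb_angle Cheb2 n k = real k * pi / (real n + 1)"
| "cheb_angle Cheb3 n k = (2 * real k - 1) * pi / (2 * real n + 1)"
| "cheb_angle Cheb4 n k = 2 * real k * pi / (2 * real n + 1)"

definition cheb_node :: "chebyshev_kind \<Rightarrow> nat \<Rightarrow> nat \<Rightarrow> real" where
  "cheb_node c n k = cos (cheb_angle c n k)"

definition christoffel :: "chebyshev_kind \<Rightarrow> nat \<Rightarrow> nat \<Rightarrow> real" where
  "christoffel c n k = inverse (\<Sum>j=0..n. (poly (cheb_poly c j) (cheb_node c n k))\<^sup>2)"

text \<open>Used for \<open>0 < m < n\<close> and \<open>0 \<le> j < n + m\<close> only.\<close>

definition vp_coeff :: "nat \<Rightarrow> nat \<Rightarrow> nat \<Rightarrow> real" where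
  "vp_coeff n m j = (if j \<le> n - m then 1 else (real n + real m - real j) / (2 * real m))"

definition vp_fundamental :: "chebyshev_kind \<Rightarrow> nat \<Rightarrow> nat \<Rightarrow> nat \<Rightarrow> real \<Rightarrow> real" where
  "vp_fundamental c n m k x =
     christoffel c n k *
     (\<Sum>j=0..n+m-1. vp_coeff n m j * poly (cheb_poly c j) x * poly (cheb_poly c j) (cheb_node c n k))"

definition vp_operator :: "chebyshev_kind \<Rightarrow> nat \<Rightarrow> nat \<Rightarrow> (real \<Rightarrow> real) \<Rightarrow> real \<Rightarrow> real" where
  "vp_operator c n m f x = (\<Sum>k=1..n. f (cheb_node c n k) * vp_fundamental c n m k x)"

text \<open>Since \<open>0 powr 0 = 0\<close> in HOL, the exponent \<open>0\<close> is treated separately, so that the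
  corresponding factor is the constant \<open>1\<close>, including at the endpoint.\<close>

definition jacobi_factor :: "real \<Rightarrow> real \<Rightarrow> real" where
  "jacobi_factor y a = (if a = 0 then 1 else y powr a)"

definition jacobi_weight :: "real \<Rightarrow> real \<Rightarrow> real \<Rightarrow> real" where
  "jacobi_weight \<gamma> \<delta> x = jacobi_factor (1 - x) \<gamma> * jacobi_factor (1 + x) \<delta>"

definition sup_norm :: "(real \<Rightarrow> real) \<Rightarrow> ennreal" where
  "sup_norm g = (SUP x\<in>{-1..1}. ennreal \<bar>g x\<bar>)"

text \<open>Functions on \<open>(-1, 1)\<close>, extended to an endpoint where \<open>u\<close> does not vanish, are represented by
  total functions. Values outside \<open>[-1, 1]\<close>, and at an endpoint where \<open>u\<close> vanishes, are
  irrelevant: at such an endpoint any product with \<open>u\<close> is \<open>0\<close>.\<close>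

definition admissible :: "(real \<Rightarrow> real) \<Rightarrow> (real \<Rightarrow> real) \<Rightarrow> bool" where
  "admissible u f \<longleftrightarrow>
     (u 1 = 0 \<longrightarrow> ((\<lambda>x. f x * u x) \<longlongrightarrow> 0) (at_left 1)) \<and>
     (u (-1) = 0 \<longrightarrow> ((\<lambda>x. f x * u x) \<longlongrightarrow> 0) (at_right (-1)))"

definition best_approx_error :: "(real \<Rightarrow> real) \<Rightarrow> nat \<Rightarrow> (real \<Rightarrow> real) \<Rightarrow> ennreal" where
  "best_approx_error u n f = (INF P\<in>{P :: real poly. degree P \<le> n}. sup_norm (\<lambda>x. (f x - poly P x) * u x))"

end

theory Submission
  imports Defs
begin

text \<open>The lower estimate holds because the operator \<open>V\<close> takes its values in the polynomials of degree at
  most \<open>n + m - 1\<close>. For the upper one, \<open>V\<close> reproduces a polynomial \<open>P\<close> of degree at most \<open>n - m\<close>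
  (\<open>vp_operator_reproduces\<close>), so \<open>f - V f = (f - P) - V (f - P)\<close>, and it suffices that \<open>V\<close> is bounded
  in the weighted supremum norm, uniformly in \<open>n\<close> and \<open>m\<close> (\<open>vp_operator_weighted_bound\<close>). That is a
  bound on the weighted Lebesgue function, the sum over \<open>k\<close> of \<open>\<bar>\<Phi>\<^sub>k x\<bar> u x / u x\<^sub>k\<close>.

  Put \<open>x = cos t\<close>. Since an orthonormal system is unique, \<open>p\<^sub>j\<close> is known (\<open>cheb_poly_eq\<close>):
  up to normalisation, \<open>p\<^sub>j (cos t)\<close> is a cosine or sine of frequency \<open>j + \<sigma>\<close>, divided by
  \<open>\<rho> t\<close>, which is \<open>1\<close>, \<open>sin t\<close>, \<open>cos (t/2)\<close> or \<open>sin (t/2)\<close> for the four kinds. With \<open>N = n + \<sigma>\<close> one gets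
  \<open>\<Phi>\<^sub>k (cos t) = \<rho> t\<^sub>k / \<rho> t \<cdot> K t t\<^sub>k / N\<close>, where \<open>K t s\<close> is the sum or the difference of the translates by
  \<open>s\<close> and \<open>-s\<close> of the profile \<open>sin (N \<theta>) sin (m \<theta>) / (4 m (sin (\<theta>/2))\<^sup>2)\<close>. Since \<open>n \<le> C0 m\<close>, this
  closed form gives \<open>\<bar>K t t\<^sub>k\<bar> = O(N / (1 + N d)\<^sup>2)\<close> with \<open>d = \<bar>sin ((t - t\<^sub>k) / 2)\<bar>\<close>. At an endpoint where
  the modes vanish, there is an additional factor, the minimum of \<open>1\<close> and \<open>N\<close> times the distance
  from the endpoint (\<open>vp_kernel_gain\<close>).

  Let \<open>a, b\<close> be \<open>sin (t/2), cos (t/2)\<close> and \<open>a\<^sub>k, b\<^sub>k\<close> the same at the node. The factors \<open>u\<close> and \<open>\<rho>\<close>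
  together are \<open>(a / a\<^sub>k) powr \<alpha> \<cdot> (b / b\<^sub>k) powr \<beta>\<close>, and for all four kinds the hypotheses on \<open>\<gamma>\<close> and \<open>\<delta>\<close>
  say that \<open>\<alpha>\<close> and \<open>\<beta>\<close> lie in the interval from \<open>-1\<close> (excluded) to \<open>2\<close>, differ by at most \<open>2\<close>, and are
  negative only at an endpoint where the modes vanish. One of the two ratios is at most
  \<open>1\<close>, say \<open>a / a\<^sub>k\<close>. Then the product of the weight ratio with \<open>K t t\<^sub>k / N\<close> is
  \<open>O((1 + N d) powr -p + (N b\<^sub>k) powr -p)\<close> with \<open>p = 2 - max 0 (-\<alpha>)\<close> (\<open>ratio_kernel_bound\<close>): the gain
  tames the singularity in \<open>a\<close> at the price of lowering the decay from \<open>2\<close> to \<open>p\<close>, and the growth in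
  \<open>b / b\<^sub>k\<close> is of order at most \<open>p\<close>, so the decay absorbs it. As \<open>p > 1\<close> and the nodes are equally
  spaced, the sum over \<open>k\<close> is bounded by a multiple of \<open>\<zeta>(p)\<close> (\<open>node_sums\<close>).\<close>

section \<open>Trigonometric form of the Chebyshev polynomials\<close>

fun cheb_mode :: "chebyshev_kind \<Rightarrow> nat \<Rightarrow> real \<Rightarrow> real" where
  "cheb_mode Cheb1 j t = cos (real j * t)"
| "cheb_mode Cheb2 j t = sin ((real j + 1) * t)"
| "cheb_mode Cheb3 j t = cos ((real j + 1/2) * t)"
| "cheb_mode Cheb4 j t = sin ((real j + 1/2) * t)"

fun freq_shift :: "chebyshev_kind \<Rightarrow> real" where
  "freq_shift Cheb1 = 0" | "freq_shift Cheb2 = 1" | "freq_shift Cheb3 = 1/2" | "freq_shift Cheb4 = 1/2"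

fun mode_sign :: "chebyshev_kind \<Rightarrow> real" where
  "mode_sign Cheb1 = 1" | "mode_sign Cheb2 = -1" | "mode_sign Cheb3 = 1" | "mode_sign Cheb4 = -1"

text \<open>The function \<open>\<rho>\<close> for which \<open>p\<^sub>j (cos t) \<rho> t\<close> is a pure cosine or sine of \<open>t\<close>.\<close>

fun mode_denom :: "chebyshev_kind \<Rightarrow> real \<Rightarrow> real" where
  "mode_denom Cheb1 t = 1"
| "mode_denom Cheb2 t = sin t"
| "mode_denom Cheb3 t = cos (t/2)"
| "mode_denom Cheb4 t = sin (t/2)"

text \<open>The unnormalised Chebyshev polynomials of the four kinds. They share the recurrence, which is the
  addition theorem for cosine and sine, and differ in the linear polynomial only.\<close>

fun cheb_rec :: "chebyshev_kind \<Rightarrow> nat \<Rightarrow> real poly" where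
  "cheb_rec c 0 = 1"
| "cheb_rec c (Suc 0) = (case c of Cheb1 \<Rightarrow> [:0, 1:] | Cheb2 \<Rightarrow> [:0, 2:] | Cheb3 \<Rightarrow> [:-1, 2:] | Cheb4 \<Rightarrow> [:1, 2:])"
| "cheb_rec c (Suc (Suc j)) = [:0, 2:] * cheb_rec c (Suc j) - cheb_rec c j"

lemma mode_denom_pos: "0 < t \<Longrightarrow> t < pi \<Longrightarrow> mode_denom c t > 0"
  by (cases c) (auto intro!: sin_gt_zero cos_gt_zero)

lemma cos_double_half: "cos t = 2 * (cos (t/2))\<^sup>2 - 1" "cos t = 1 - 2 * (sin (t/2))\<^sup>2" for t :: real
  using cos_double_cos[of "t/2"] cos_double_sin[of "t/2"] by simp_all

lemma cheb_mode_alt: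
  "cheb_mode c j t = (if mode_sign c = 1 then cos ((real j + freq_shift c) * t) else sin ((real j + freq_shift c) * t))"
  by (cases c) auto

lemma cheb_mode_rec: "cheb_mode c (Suc (Suc j)) t = 2 * cos t * cheb_mode c (Suc j) t - cheb_mode c j t"
proof -
  define x where "x = (real j + 1 + freq_shift c) * t"
  have "(real j + freq_shift c) * t = x - t" "(real (Suc j) + freq_shift c) * t = x"
    "(real (Suc (Suc j)) + freq_shift c) * t = x + t"
    by (auto simp: x_def algebra_simps)
  then show ?thesis
    by (simp add: cheb_mode_alt cos_add cos_diff sin_add sin_diff)
qed

lemma poly_cheb_rec_cos: "poly (cheb_rec c j) (cos t) * mode_denom c t = cheb_mode c j t"
proof (induction c j rule: cheb_rec.induct)
  case (1 c)
  show ?case by (cases c) auto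
next
  case (2 c)
  have half: "sin t = 2 * sin (t/2) * cos (t/2)" using sin_double[of "t/2"] by simp
  have three_halves: "(real 1 + 1/2) * t = t + t/2" by simp
  have c3: "(2 * cos t - 1) * cos (t/2) = cos (t + t/2)"
  proof -
    have "(2 * cos t - 1) * cos (t/2) = cos t * cos (t/2) + (cos t - 1) * cos (t/2)"
      by (simp add: algebra_simps)
    also have "cos t - 1 = - 2 * sin (t/2) * sin (t/2)"
      using cos_double_half(2)[of t] unfolding power2_eq_square by linarith
    also have "cos t * cos (t/2) + (- 2 * sin (t/2) * sin (t/2)) * cos (t/2) = cos t * cos (t/2) - sin t * sin (t/2)"
      unfolding half by (simp add: algebra_simps)
    finally show ?thesis by (simp only: cos_add)
  qed
  have c4: "(1 + 2 * cos t) * sin (t/2) = sin (t + t/2)"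
  proof -
    have "(1 + 2 * cos t) * sin (t/2) = cos t * sin (t/2) + (1 + cos t) * sin (t/2)"
      by (simp add: algebra_simps)
    also have "1 + cos t = 2 * cos (t/2) * cos (t/2)"
      using cos_double_half(1)[of t] unfolding power2_eq_square by linarith
    also have "cos t * sin (t/2) + (2 * cos (t/2) * cos (t/2)) * sin (t/2) = sin t * cos (t/2) + cos t * sin (t/2)"
      unfolding half by (simp add: algebra_simps)
    finally show ?thesis by (simp only: sin_add)
  qed
  show ?case
  proof (cases c)
    case Cheb1 then show ?thesis by simp
  next
    case Cheb2 then show ?thesis using sin_double[of t] by (simp add: mult.commute)
  next
    case Cheb3
    have "cheb_mode c (Suc 0) t = cos (t + t/2)" using Cheb3 three_halves by simp
    then show ?thesis using Cheb3 c3 by (simp add: mult.commute)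
  next
    case Cheb4
    have "cheb_mode c (Suc 0) t = sin (t + t/2)" using Cheb4 three_halves by simp
    then show ?thesis using Cheb4 c4 by (simp add: mult.commute)
  qed
next
  case (3 c j)
  then show ?case by (simp add: cheb_mode_rec algebra_simps)
qed

lemma cheb_rec_degree: "degree (cheb_rec c j) = j \<and> lead_coeff (cheb_rec c j) > 0"
proof (induction c j rule: cheb_rec.induct)
  case (1 c) then show ?case by simp
next
  case (2 c) then show ?case by (cases c) auto
next
  case (3 c j)
  let ?q = "[:0, 2:] * cheb_rec c (Suc j)"
  have nz: "cheb_rec c (Suc j) \<noteq> 0" using 3 by (metis leading_coeff_0_iff less_irrefl)
  have "degree ?q = 1 + degree (cheb_rec c (Suc j))"
    using nz by (subst degree_mult_eq) (auto)
  then have dq: "degree ?q = Suc (Suc j)" using 3 by simp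
  have "lead_coeff (cheb_rec c (Suc j)) > 0" using 3 by blast
  then have lq: "lead_coeff ?q > 0" unfolding lead_coeff_mult by simp
  have small: "degree (- cheb_rec c j) < degree ?q" using 3 dq by simp
  have "degree (?q + - cheb_rec c j) = Suc (Suc j)"
    using degree_add_eq_left[OF small] dq by simp
  moreover have "lead_coeff (?q + - cheb_rec c j) = lead_coeff ?q"
    using lead_coeff_add_le[OF small] by (simp add: add.commute)
  ultimately show ?case using lq by simp
qed

section \<open>The orthonormal polynomials\<close>

fun mode_norm :: "chebyshev_kind \<Rightarrow> nat \<Rightarrow> real" where
  "mode_norm Cheb1 j = (if j = 0 then 1 / sqrt pi else sqrt (2 / pi))"
| "mode_norm Cheb2 j = sqrt (2 / pi)"
| "mode_norm Cheb3 j = 1 / sqrt pi"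
| "mode_norm Cheb4 j = 1 / sqrt pi"

definition cheb_explicit :: "chebyshev_kind \<Rightarrow> nat \<Rightarrow> real poly" where
  "cheb_explicit c j = smult (mode_norm c j) (cheb_rec c j)"

text \<open>Substitution \<open>x = cos t\<close> on the closed interval, for integrands that may be unbounded at
  \<open>-1\<close> and \<open>1\<close>: if \<open>H\<close> is a primitive of \<open>h\<close>, then \<open>- H \<circ> arccos\<close> is continuous up to the
  endpoints and a primitive of \<open>g\<close> inside, which is all that the fundamental theorem needs.\<close>

lemma has_integral_arccos:
  fixes h g :: "real \<Rightarrow> real"
  assumes cont: "continuous_on {0..pi} h" and I: "(h has_integral I) {0..pi}"
    and g: "\<And>x. -1 < x \<Longrightarrow> x < 1 \<Longrightarrow> g x = h (arccos x) / sqrt (1 - x\<^sup>2)"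
  shows "(g has_integral I) {-1..1}"
proof -
  define H where "H t = integral {0..t} h" for t
  have contH: "continuous_on {0..pi} H"
    unfolding H_def by (rule indefinite_integral_continuous_1[OF integrable_continuous_real[OF cont]])
  have "(g has_integral (- H (arccos 1)) - (- H (arccos (-1)))) {-1..1}"
  proof (rule fundamental_theorem_of_calculus_interior)
    show "continuous_on {-1..1} (\<lambda>x. - H (arccos x))"
      by (intro continuous_on_minus continuous_on_compose2[OF contH] continuous_on_arccos' )
         (auto intro: arccos_lbound arccos_ubound)
    fix x :: real assume x: "x \<in> {-1<..<1}"
    then have ar: "0 < arccos x" "arccos x < pi" using arccos_lt_bounded[of x] by auto
    have "(H has_real_derivative h (arccos x)) (at (arccos x) within {0..pi})"
      unfolding H_def using integral_has_real_derivative[OF cont, of "arccos x"] ar by auto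
    then have "(H has_real_derivative h (arccos x)) (at (arccos x))"
      using ar by (simp add: at_within_Icc_at)
    then have "((\<lambda>x. H (arccos x)) has_real_derivative h (arccos x) * inverse (- sqrt (1 - x\<^sup>2))) (at x)"
      by (rule DERIV_chain2) (use x DERIV_arccos in auto)
    then have "((\<lambda>x. - H (arccos x)) has_real_derivative - (h (arccos x) * inverse (- sqrt (1 - x\<^sup>2)))) (at x)"
      by (rule DERIV_minus)
    moreover have "- (h (arccos x) * inverse (- sqrt (1 - x\<^sup>2))) = g x"
      using g[of x] x by (simp add: field_simps)
    ultimately show "((\<lambda>x. - H (arccos x)) has_vector_derivative g x) (at x)"
      by (simp add: has_real_derivative_iff_has_vector_derivative)
  qed simp
  moreover have "H 0 = 0" "H pi = I" unfolding H_def using I by (auto simp: integral_unique)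
  ultimately show ?thesis by simp
qed

lemma has_integral_cos_int:
  assumes "r \<in> \<int>" shows "((\<lambda>t. cos (r * t)) has_integral (if r = 0 then pi else 0)) {0..pi}"
proof (cases "r = 0")
  case True
  have "((\<lambda>t::real. 1::real) has_integral pi) {0..pi}" using has_integral_const_real[of "1::real" 0 pi] by simp
  then show ?thesis using True by simp
next
  case False
  have "((\<lambda>t. cos (r * t)) has_integral (sin (r * pi) / r - sin (r * 0) / r)) {0..pi}"
    by (rule fundamental_theorem_of_calculus)
       (use False in \<open>auto intro!: derivative_eq_intros simp: has_real_derivative_iff_has_vector_derivative[symmetric]\<close>)
  moreover have "sin (r * pi) = 0" using assms by (metis sin_npi_int Ints_cases mult.commute)
  ultimately show ?thesis using False by simp
qed

lemma cheb_mode_prod: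
  "2 * (cheb_mode c i t * cheb_mode c j s) =
    cos ((real i + freq_shift c) * t - (real j + freq_shift c) * s) +
    mode_sign c * cos ((real i + freq_shift c) * t + (real j + freq_shift c) * s)"
  by (cases c) (auto simp: cos_add cos_diff)

lemma cheb_mode_integral:
  "((\<lambda>t. cheb_mode c i t * cheb_mode c j t) has_integral
     (if i = j then if c = Cheb1 \<and> i = 0 then pi else pi / 2 else 0)) {0..pi}"
proof -
  let ?r = "real i - real j" and ?s = "real i + real j + 2 * freq_shift c"
  have ri: "?r \<in> \<int>" by auto
  have si: "?s \<in> \<int>" by (cases c) (auto intro!: Ints_add)
  have eq: "cheb_mode c i t * cheb_mode c j t = (cos (?r * t) + mode_sign c * cos (?s * t)) / 2" for t
    using cheb_mode_prod[of c i t j t] by (simp add: algebra_simps)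
  have "((\<lambda>t. (cos (?r * t) + mode_sign c * cos (?s * t)) / 2) has_integral
     ((if ?r = 0 then pi else 0) + mode_sign c * (if ?s = 0 then pi else 0)) / 2) {0..pi}"
    by (intro has_integral_divide has_integral_add has_integral_mult_right has_integral_cos_int ri si)
  moreover have "((if ?r = 0 then pi else 0) + mode_sign c * (if ?s = 0 then pi else 0)) / 2 =
      (if i = j then if c = Cheb1 \<and> i = 0 then pi else pi / 2 else 0)"
    by (cases c) (auto simp: add_nonneg_eq_0_iff)
  ultimately show ?thesis unfolding eq by simp
qed

definition weight_const :: "chebyshev_kind \<Rightarrow> real" where
  "weight_const c = (if c = Cheb3 \<or> c = Cheb4 then 2 else 1)"

text \<open>The weight, multiplied by the Jacobian of \<open>x = cos t\<close>, cancels the squared denominator, so that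
  orthogonality of the polynomials is orthogonality of the modes on \<open>[0, \<pi>]\<close>.\<close>

lemma cheb_weight_cos:
  assumes "0 < t" "t < pi"
  shows "cheb_weight c (cos t) * sin t = weight_const c * (mode_denom c t)\<^sup>2"
proof -
  have s: "sin t > 0" using assms by (simp add: sin_gt_zero)
  have a: "sin (t/2) > 0" using assms by (simp add: sin_gt_zero)
  have b: "cos (t/2) > 0" using assms by (simp add: cos_gt_zero)
  have sq: "sqrt (1 - (cos t)\<^sup>2) = sin t" using s by (simp add: sin_squared_eq[symmetric])
  have st: "sin t = 2 * sin (t/2) * cos (t/2)" using sin_double[of "t/2"] by simp
  have q: "1 + cos t = 2 * (cos (t/2))\<^sup>2" "1 - cos t = 2 * (sin (t/2))\<^sup>2"
    using cos_double_half[of t] by simp_all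
  show ?thesis
  proof (cases c)
    case Cheb1
    then show ?thesis using s by (simp add: sq weight_const_def)
  next
    case Cheb2
    then show ?thesis by (simp add: sq weight_const_def) (simp add: power2_eq_square)
  qed (use a b in \<open>simp_all add: q weight_const_def real_sqrt_divide real_sqrt_mult st power2_eq_square\<close>)
qed

lemma cheb_explicit_orthonormal: "orthonormal_system (cheb_weight c) (cheb_explicit c)"
  unfolding orthonormal_system_def
proof (intro conjI allI)
  fix j
  have k: "mode_norm c j > 0" by (cases c) auto
  then show "degree (cheb_explicit c j) = j" "lead_coeff (cheb_explicit c j) > 0"
    using cheb_rec_degree[of c j] by (auto simp: cheb_explicit_def)
next
  fix i j
  define h where "h t = (mode_norm c i * mode_norm c j * weight_const c) * (cheb_mode c i t * cheb_mode c j t)" for t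
  show "((\<lambda>x. poly (cheb_explicit c i) x * poly (cheb_explicit c j) x * cheb_weight c x) has_integral
           (if i = j then 1 else 0)) {-1..1}"
  proof (rule has_integral_arccos)
    show "continuous_on {0..pi} h" unfolding h_def
      by (cases c) (auto intro!: continuous_intros)
    have "(h has_integral (mode_norm c i * mode_norm c j * weight_const c) *
        (if i = j then if c = Cheb1 \<and> i = 0 then pi else pi / 2 else 0)) {0..pi}"
      unfolding h_def by (intro has_integral_mult_right cheb_mode_integral)
    moreover have "(mode_norm c i * mode_norm c j * weight_const c) *
        (if i = j then if c = Cheb1 \<and> i = 0 then pi else pi / 2 else 0) = (if i = j then 1 else 0)"
      by (cases c) (auto simp: weight_const_def)
    ultimately show "(h has_integral (if i = j then 1 else 0)) {0..pi}" by simp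
    fix x :: real assume x: "-1 < x" "x < 1"
    define t where "t = arccos x"
    have t: "0 < t" "t < pi" using x arccos_lt_bounded[of x] by (auto simp: t_def)
    have xt: "x = cos t" using x by (simp add: t_def)
    have st: "sqrt (1 - x\<^sup>2) = sin t" using t sin_gt_zero[of t] by (simp add: xt sin_squared_eq[symmetric])
    have s: "sin t > 0" using t by (simp add: sin_gt_zero)
    have w: "cheb_weight c x = weight_const c * (mode_denom c t)\<^sup>2 / sin t"
      using cheb_weight_cos[OF t, of c] s by (simp add: xt field_simps)
    show "poly (cheb_explicit c i) x * poly (cheb_explicit c j) x * cheb_weight c x = h (arccos x) / sqrt (1 - x\<^sup>2)"
      unfolding w st h_def t_def[symmetric] poly_cheb_rec_cos[symmetric] xt[symmetric]
      by (simp add: cheb_explicit_def power2_eq_square)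
  qed
qed

lemma poly_expansion:
  fixes p :: "nat \<Rightarrow> 'a :: field poly"
  assumes "\<And>j. degree (p j) = j" "\<And>j. lead_coeff (p j) \<noteq> 0" "degree q < n"
  shows "\<exists>a. q = (\<Sum>j<n. smult (a j) (p j))"
  using assms(3)
proof (induction n arbitrary: q)
  case 0 then show ?case by simp
next
  case (Suc n)
  define b where "b = coeff q n / lead_coeff (p n)"
  define r where "r = q - smult b (p n)"
  have c0: "coeff r n = 0" using assms(1)[of n] assms(2)[of n] by (simp add: r_def b_def)
  have dr: "degree r \<le> n"
    unfolding r_def using Suc.prems assms(1)[of n] by (intro degree_diff_le) (auto intro: order.trans[OF degree_smult_le])
  have "\<exists>a. r = (\<Sum>j<n. smult (a j) (p j))"
  proof (cases "r = 0")
    case True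
    then show ?thesis by (intro exI[of _ "\<lambda>_. 0"]) simp
  next
    case False
    then have "degree r \<noteq> n" using c0 by (metis leading_coeff_0_iff)
    then show ?thesis using dr by (intro Suc.IH) simp
  qed
  then obtain a where a: "r = (\<Sum>j<n. smult (a j) (p j))" ..
  have "q = (\<Sum>j<Suc n. smult ((a(n := b)) j) (p j))"
    using a by (simp add: r_def algebra_simps)
  then show ?case by blast
qed

text \<open>The \<open>n\<close>-th polynomials of two systems that agree below \<open>n\<close> differ, after matching the leading
  coefficients, by a combination of the lower ones. Both are orthogonal to these, so the difference
  is \<open>0\<close>; the norm \<open>1\<close> and the sign condition then fix the factor.\<close>

lemma orthonormal_system_unique:
  assumes p: "orthonormal_system w p" and q: "orthonormal_system w q"
  shows "p = q"
proof
  fix n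
  show "p n = q n"
  proof (induction n rule: less_induct)
    case (less n)
    have d: "degree (p j) = j" "lead_coeff (p j) > 0" "degree (q j) = j" "lead_coeff (q j) > 0" for j
      using p q unfolding orthonormal_system_def by blast+
    have ip: "((\<lambda>x. poly (p i) x * poly (p j) x * w x) has_integral (if i = j then 1 else 0)) {-1..1}" for i j
      using p by (auto simp: orthonormal_system_def)
    have iq: "((\<lambda>x. poly (q i) x * poly (q j) x * w x) has_integral (if i = j then 1 else 0)) {-1..1}" for i j
      using q by (auto simp: orthonormal_system_def)
    \<comment> \<open>\<open>b\<close> matches the leading coefficients, so that \<open>p n - b q n\<close> has degree below \<open>n\<close>.\<close>
    define b where "b = lead_coeff (p n) / lead_coeff (q n)"
    have b: "b > 0" using d[of n] by (simp add: b_def)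
    define r where "r = p n - smult b (q n)"
    have "r = 0"
    proof (rule ccontr)
      assume r0: "r \<noteq> 0"
      have c0: "coeff r n = 0" using d[of n] by (simp add: r_def b_def)
      have "degree r \<le> n" unfolding r_def using d[of n] 
        by (intro degree_diff_le) (auto intro: order.trans[OF degree_smult_le])
      moreover have "degree r \<noteq> n" using c0 r0 by (metis leading_coeff_0_iff)
      ultimately have dr: "degree r < n" by simp
      obtain a where a: "r = (\<Sum>j<n. smult (a j) (p j))"
        using poly_expansion[of p r n] d dr by (metis less_irrefl)
      have "a i = 0" if i: "i < n" for i
      proof -
        have "((\<lambda>x. \<Sum>j<n. a j * (poly (p j) x * poly (p i) x * w x)) has_integral
            (\<Sum>j<n. a j * (if j = i then 1 else 0))) {-1..1}"
          by (intro has_integral_sum has_integral_mult_right ip) auto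
        moreover have "(\<Sum>j<n. a j * (if j = i then 1 else 0)) = a i"
          using i by (simp add: if_distrib cong: if_cong)
        moreover have "(\<lambda>x. \<Sum>j<n. a j * (poly (p j) x * poly (p i) x * w x)) = (\<lambda>x. poly r x * poly (p i) x * w x)"
          by (simp add: a poly_sum sum_distrib_right mult.assoc)
        ultimately have 1: "((\<lambda>x. poly r x * poly (p i) x * w x) has_integral a i) {-1..1}" by simp
        have "((\<lambda>x. poly (p n) x * poly (p i) x * w x - b * (poly (q n) x * poly (q i) x * w x)) has_integral
           (if n = i then 1 else 0) - b * (if n = i then 1 else 0)) {-1..1}"
          by (intro has_integral_diff has_integral_mult_right ip iq)
        moreover have "(\<lambda>x. poly (p n) x * poly (p i) x * w x - b * (poly (q n) x * poly (q i) x * w x)) =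
          (\<lambda>x. poly r x * poly (p i) x * w x)"
          using less[OF i] by (simp add: r_def algebra_simps)
        ultimately have "((\<lambda>x. poly r x * poly (p i) x * w x) has_integral 0) {-1..1}" using i by simp
        with 1 show ?thesis by (rule has_integral_unique)
      qed
      then have "r = 0" using a by simp
      with r0 show False by simp
    qed
    then have pn: "p n = smult b (q n)" by (simp add: r_def)
    have "((\<lambda>x. b\<^sup>2 * (poly (q n) x * poly (q n) x * w x)) has_integral b\<^sup>2 * 1) {-1..1}"
      using has_integral_mult_right[OF iq[of n n], of "b\<^sup>2"] by simp
    moreover have "(\<lambda>x. b\<^sup>2 * (poly (q n) x * poly (q n) x * w x)) = (\<lambda>x. poly (p n) x * poly (p n) x * w x)"
      by (simp add: pn power2_eq_square algebra_simps)
    ultimately have "((\<lambda>x. poly (p n) x * poly (p n) x * w x) has_integral b\<^sup>2) {-1..1}" by simp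
    then have "b\<^sup>2 = 1" using has_integral_unique[OF _ ip[of n n]] by simp
    then have "b = 1" using b by (simp add: power2_eq_1_iff)
    then show ?case using pn by simp
  qed
qed

lemma cheb_poly_eq: "cheb_poly c = cheb_explicit c"
  unfolding orthonormal_poly_def
  using cheb_explicit_orthonormal orthonormal_system_unique by (intro the_equality) blast+

section \<open>Nodes, Christoffel numbers and discrete orthogonality\<close>

text \<open>With \<open>N = n + freq_shift c\<close> the zeros of the \<open>n\<close>-th mode are \<open>(k - node_shift c) \<pi> / N\<close>.\<close>

fun node_shift :: "chebyshev_kind \<Rightarrow> real" where
  "node_shift Cheb1 = 1/2" | "node_shift Cheb2 = 0" | "node_shift Cheb3 = 1/2" | "node_shift Cheb4 = 0"

text \<open>The constant mode of the first kind has twice the squared norm of all the other modes and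
  therefore enters kernels with the factor one half.\<close>

definition mode_half :: "chebyshev_kind \<Rightarrow> nat \<Rightarrow> real" where
  "mode_half c j = (if c = Cheb1 \<and> j = 0 then 1/2 else 1)"

lemma freq_shift_bounds: "0 \<le> freq_shift c" "freq_shift c \<le> 1"
  by (cases c; simp)+

lemma cheb_angle_eq: "cheb_angle c n k = (real k - node_shift c) * pi / (real n + freq_shift c)"
  by (cases c) (auto simp: divide_simps, auto simp: algebra_simps)

lemma freq_times_angle: "n > 0 \<Longrightarrow> (real n + freq_shift c) * cheb_angle c n k = (real k - node_shift c) * pi"
  using freq_shift_bounds[of c] by (simp add: cheb_angle_eq)

lemma cheb_angle_bounds:
  assumes "1 \<le> k" "k \<le> n"
  shows "real k * pi / (2 * (real n + freq_shift c)) \<le> cheb_angle c n k"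
    and "real (n + 1 - k) * pi / (2 * (real n + freq_shift c)) \<le> pi - cheb_angle c n k"
    and "0 < cheb_angle c n k" "cheb_angle c n k < pi"
proof -
  let ?N = "real n + freq_shift c"
  have N: "?N > 0" using assms freq_shift_bounds[of c] by simp
  have k: "real k \<ge> 1" "real k \<le> real n" using assms by simp_all
  have "real k / 2 \<le> real k - node_shift c" using k by (cases c) auto
  then have "real k / 2 * pi / ?N \<le> (real k - node_shift c) * pi / ?N"
    using N by (intro divide_right_mono mult_right_mono) auto
  then show 1: "real k * pi / (2 * ?N) \<le> cheb_angle c n k"
    by (simp add: cheb_angle_eq)
  have e: "pi - cheb_angle c n k = (?N - (real k - node_shift c)) * pi / ?N"
    using N by (simp add: cheb_angle_eq field_simps)
  have "real (n + 1 - k) / 2 \<le> ?N - (real k - node_shift c)" using k assms by (cases c) (auto simp: of_nat_diff)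
  then have "real (n + 1 - k) / 2 * pi / ?N \<le> (?N - (real k - node_shift c)) * pi / ?N"
    using N by (intro divide_right_mono mult_right_mono) auto
  then show 2: "real (n + 1 - k) * pi / (2 * ?N) \<le> pi - cheb_angle c n k"
    by (simp add: e)
  have "real k * pi / (2 * ?N) > 0" "real (n + 1 - k) * pi / (2 * ?N) > 0" using k N assms by auto
  then show "0 < cheb_angle c n k" "cheb_angle c n k < pi" using 1 2 by linarith+
qed

lemma cheb_mode_node: "n > 0 \<Longrightarrow> cheb_mode c n (cheb_angle c n k) = 0"
proof -
  assume n: "n > 0"
  have "cos ((real k - 1/2) * pi) = 0"
    using cos_diff[of "real k * pi" "pi/2"] sin_npi[of k] by (simp add: left_diff_distrib)
  then show ?thesis using sin_npi[of k] unfolding cheb_mode_alt freq_times_angle[OF n] by (cases c) auto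
qed

lemma two_sin_mult: "2 * sin a * cos b = sin (b + a) - sin (b - a)" "2 * sin a * sin b = cos (b - a) - cos (b + a)"
  for a b :: real
  by (simp_all add: sin_add sin_diff cos_add cos_diff)

text \<open>The Dirichlet kernel. For the second kind the frequency \<open>0\<close> is absent from the sum, which
  shifts the kernel by the constant one half.\<close>

lemma dirichlet_closed:
  "2 * sin (\<theta>/2) * (\<Sum>j\<le>M. mode_half c j * cos ((real j + freq_shift c) * \<theta>)) =
     sin ((real M + freq_shift c + 1/2) * \<theta>) - (if c = Cheb2 then sin (\<theta>/2) else 0)"
proof (induction M)
  case 0
  have "2 * sin (\<theta>/2) * cos \<theta> = sin (3/2 * \<theta>) - sin (\<theta>/2)"
    using two_sin_mult(1)[of "\<theta>/2" \<theta>] by (simp add: algebra_simps)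
  then show ?case using sin_double[of "\<theta>/2"] by (cases c) (auto simp: mode_half_def)
next
  case (Suc M)
  let ?y = "(real (Suc M) + freq_shift c) * \<theta>"
  have "2 * sin (\<theta>/2) * cos ?y = sin (?y + \<theta>/2) - sin (?y - \<theta>/2)"
    by (rule two_sin_mult)
  also have "?y + \<theta>/2 = (real (Suc M) + freq_shift c + 1/2) * \<theta>" by (simp add: algebra_simps)
  also have "?y - \<theta>/2 = (real M + freq_shift c + 1/2) * \<theta>" by (simp add: algebra_simps)
  finally have "2 * sin (\<theta>/2) * (mode_half c (Suc M) * cos ?y) =
      sin ((real (Suc M) + freq_shift c + 1/2) * \<theta>) - sin ((real M + freq_shift c + 1/2) * \<theta>)"
    by (simp add: mode_half_def)
  then show ?case using Suc by (simp only: sum.atMost_Suc distrib_left) 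
qed

text \<open>Sums of Dirichlet kernels. A de la Vallee Poussin kernel is a difference of two of these, with
  the lengths \<open>n + m\<close> and \<open>n - m\<close>.\<close>

lemma fejer_closed:
  "4 * (sin (\<theta>/2))\<^sup>2 * (\<Sum>j<M. real (M - j) * (mode_half c j * cos ((real j + freq_shift c) * \<theta>))) =
     cos (freq_shift c * \<theta>) - cos ((real M + freq_shift c) * \<theta>) - (if c = Cheb2 then 2 * real M * (sin (\<theta>/2))\<^sup>2 else 0)"
proof (induction M)
  case 0
  then show ?case by simp
next
  case (Suc M)
  let ?q = "\<lambda>j. mode_half c j * cos ((real j + freq_shift c) * \<theta>)"
  let ?s = "sin (\<theta>/2)"
  have "(\<Sum>j<Suc M. real (Suc M - j) * ?q j) = (\<Sum>j<Suc M. real (M - j) * ?q j + ?q j)"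
    by (intro sum.cong) (auto simp: Suc_diff_le algebra_simps)
  also have "\<dots> = (\<Sum>j<M. real (M - j) * ?q j) + (\<Sum>j\<le>M. ?q j)"
    by (simp add: sum.distrib lessThan_Suc_atMost[symmetric])
  finally have 1: "4 * ?s\<^sup>2 * (\<Sum>j<Suc M. real (Suc M - j) * ?q j) =
    4 * ?s\<^sup>2 * (\<Sum>j<M. real (M - j) * ?q j) + 2 * ?s * (2 * ?s * (\<Sum>j\<le>M. ?q j))"
    by (simp add: power2_eq_square algebra_simps)
  let ?y = "(real M + freq_shift c + 1/2) * \<theta>"
  have "2 * ?s * sin ?y = cos (?y - \<theta>/2) - cos (?y + \<theta>/2)"
    by (rule two_sin_mult)
  also have "?y - \<theta>/2 = (real M + freq_shift c) * \<theta>" by (simp add: algebra_simps)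
  also have "?y + \<theta>/2 = (real (Suc M) + freq_shift c) * \<theta>" by (simp add: algebra_simps)
  finally have 2: "2 * ?s * sin ?y = cos ((real M + freq_shift c) * \<theta>) - cos ((real (Suc M) + freq_shift c) * \<theta>)" .
  show ?case
    unfolding 1 Suc dirichlet_closed using 2
    by (cases c) (auto simp: right_diff_distrib power2_eq_square algebra_simps)
qed

text \<open>The sum is a Dirichlet kernel at twice the node, where \<open>N\<close> times the angle is a multiple of
  \<open>\<pi>\<close>, up to the shift; this gives the Christoffel numbers.\<close>

lemma mode_square_sum:
  assumes "1 \<le> k" "k \<le> n"
  shows "(\<Sum>j=0..n. mode_half c j * (cheb_mode c j (cheb_angle c n k))\<^sup>2) = (real n + freq_shift c) / 2"
proof -
  let ?t = "cheb_angle c n k" and ?N = "real n + freq_shift c"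
  have half2: "2 * ?t / 2 = ?t" by simp
  obtain M where M: "n = Suc M" using assms by (cases n) auto
  have s: "sin ?t > 0" using cheb_angle_bounds[OF assms, of c] by (simp add: sin_gt_zero)
  let ?D = "\<Sum>j\<le>M. mode_half c j * cos ((real j + freq_shift c) * (2 * ?t))"
  have "(real M + freq_shift c + 1/2) * (2 * ?t) = 2 * ((real k - node_shift c) * pi) - ?t"
    using freq_times_angle[of n c k] M by (simp add: algebra_simps)
  moreover have "sin (2 * ((real k - node_shift c) * pi) - ?t) = mode_sign c * sin ?t"
  proof -
    have "2 * ((real k - node_shift c) * pi) = 2 * real k * pi - (2 * node_shift c) * pi" by (simp add: algebra_simps)
    moreover have "2 * node_shift c = (if mode_sign c = 1 then 1 else 0)" by (cases c) auto
    moreover have "sin (2 * (real k * pi)) = 0" "cos (2 * (real k * pi)) = 1"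
      using sin_2npi[of k] cos_2npi[of k] by (simp_all add: mult.assoc)
    ultimately show ?thesis by (cases c) (auto simp: sin_diff cos_diff mult.assoc)
  qed
  ultimately have "2 * sin ?t * ?D = mode_sign c * sin ?t - (if c = Cheb2 then sin ?t else 0)"
    using dirichlet_closed[of "2 * ?t" c M] by (simp only: half2)
  then have "sin ?t * (2 * ?D) = sin ?t * (mode_sign c - (if c = Cheb2 then 1 else 0))"
    by (simp add: algebra_simps split: if_splits)
  then have D: "2 * ?D = mode_sign c - (if c = Cheb2 then 1 else 0)"
    using s by (simp del: if_split)
  have H: "(\<Sum>j\<le>M. mode_half c j) = real n - (if c = Cheb1 then 1/2 else 0)"
    unfolding M by (induction M) (auto simp: mode_half_def)
  have sq: "2 * (mode_half c j * (cheb_mode c j ?t)\<^sup>2) =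
      mode_half c j + mode_sign c * (mode_half c j * cos ((real j + freq_shift c) * (2 * ?t)))" for j
  proof -
    have "2 * (mode_half c j * (cheb_mode c j ?t)\<^sup>2) = mode_half c j * (2 * (cheb_mode c j ?t * cheb_mode c j ?t))"
      by (simp add: power2_eq_square)
    then show ?thesis unfolding cheb_mode_prod by (simp add: algebra_simps)
  qed
  have "(\<Sum>j=0..n. mode_half c j * (cheb_mode c j ?t)\<^sup>2) = (\<Sum>j\<le>M. mode_half c j * (cheb_mode c j ?t)\<^sup>2)"
    using cheb_mode_node[of n c k] by (simp add: M atMost_atLeast0)
  moreover have "2 * (\<Sum>j\<le>M. mode_half c j * (cheb_mode c j ?t)\<^sup>2) = (\<Sum>j\<le>M. mode_half c j) + mode_sign c * ?D"
    by (simp only: sum_distrib_left sum.distrib[symmetric] sq)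
  ultimately show ?thesis using H D by (cases c) auto
qed

lemma mode_norm_sq: "weight_const c * (mode_norm c j)\<^sup>2 * pi = 2 * mode_half c j"
  by (cases c) (auto simp: weight_const_def mode_half_def power_divide)

lemma poly_cheb_cos:
  assumes "0 < t" "t < pi"
  shows "poly (cheb_poly c j) (cos t) = mode_norm c j * cheb_mode c j t / mode_denom c t"
  using mode_denom_pos[OF assms, of c] poly_cheb_rec_cos[of c j t]
  by (simp add: cheb_poly_eq cheb_explicit_def field_simps)

lemma weight_const_pos: "weight_const c > 0"
  by (simp add: weight_const_def)

lemma christoffel_eq:
  assumes "1 \<le> k" "k \<le> n"
  shows "christoffel c n k = weight_const c * pi * (mode_denom c (cheb_angle c n k))\<^sup>2 / (real n + freq_shift c)"
proof -
  let ?t = "cheb_angle c n k" and ?W = "weight_const c * pi"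
  have t: "0 < ?t" "?t < pi" using cheb_angle_bounds[OF assms] by auto
  have d: "mode_denom c ?t > 0" using mode_denom_pos[OF t] .
  have W: "?W > 0" using weight_const_pos[of c] by simp
  have halves: "2 / X * (Y / 2) = Y / X" for X Y :: real by simp
  have n: "(mode_norm c j)\<^sup>2 = 2 * mode_half c j / ?W" for j
    using mode_norm_sq[of c j] W weight_const_pos[of c] by (subst eq_divide_eq) (simp add: mult_ac)
  have "(\<Sum>j=0..n. (poly (cheb_poly c j) (cheb_node c n k))\<^sup>2) =
     (\<Sum>j=0..n. 2 / (?W * (mode_denom c ?t)\<^sup>2) * (mode_half c j * (cheb_mode c j ?t)\<^sup>2))"
    unfolding cheb_node_def poly_cheb_cos[OF t]
    by (intro sum.cong refl) (simp add: power_divide power_mult_distrib n)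
  also have "\<dots> = 2 / (?W * (mode_denom c ?t)\<^sup>2) * ((real n + freq_shift c) / 2)"
    unfolding sum_distrib_left[symmetric] mode_square_sum[OF assms] ..
  also have "\<dots> = (real n + freq_shift c) / (?W * (mode_denom c ?t)\<^sup>2)"
    by (rule halves)
  finally show ?thesis unfolding christoffel_def by simp
qed

text \<open>Summation over the nodes telescopes after multiplication by the sine of half the step. The
  remainder depends on \<open>r\<close> only through its parity, which makes the two terms that come from a
  product of modes cancel.\<close>

lemma node_cos_sum:
  assumes n: "n > 0" and r: "r \<in> \<int>" "r \<noteq> 0" "\<bar>r\<bar> < 2 * (real n + freq_shift c)"
  shows "2 * (\<Sum>k=1..n. cos (r * cheb_angle c n k)) =
     - (if c = Cheb2 \<or> c = Cheb3 then cos (r * pi) else 0) - (if c = Cheb2 \<or> c = Cheb4 then 1 else 0)"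
proof -
  let ?N = "real n + freq_shift c"
  define A where "A = r * pi / ?N"
  have N: "?N > 0" using n freq_shift_bounds[of c] by simp
  have "pi * \<bar>r\<bar> < pi * (2 * ?N)" using r by (intro mult_strict_left_mono) auto
  then have A: "\<bar>A / 2\<bar> < pi" "A \<noteq> 0" using r N by (auto simp: A_def abs_mult field_simps)
  have s: "sin (A/2) \<noteq> 0"
    using A sin_gt_zero[of "A/2"] sin_gt_zero[of "-A/2"] by (cases "A > 0") auto
  have AN: "A * ?N = r * pi" using N by (simp add: A_def)
  have an: "r * cheb_angle c n k = A * (real k - node_shift c)" for k
    by (simp add: A_def cheb_angle_eq)
  have "2 * sin (A/2) * (\<Sum>k=1..M. cos (A * (real k - node_shift c))) =
     sin (A * (real M + 1/2 - node_shift c)) - sin (A * (1/2 - node_shift c))" for M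
  proof (induction M)
    case 0 then show ?case by simp
  next
    case (Suc M)
    let ?y = "A * (real (Suc M) - node_shift c)"
    have "2 * sin (A/2) * cos ?y = sin (?y + A/2) - sin (?y - A/2)" by (rule two_sin_mult)
    also have "?y + A/2 = A * (real (Suc M) + 1/2 - node_shift c)" by (simp add: algebra_simps)
    also have "?y - A/2 = A * (real M + 1/2 - node_shift c)" by (simp add: algebra_simps)
    finally have "2 * sin (A/2) * cos ?y =
       sin (A * (real (Suc M) + 1/2 - node_shift c)) - sin (A * (real M + 1/2 - node_shift c))" by simp
    then show ?case using Suc by (simp add: distrib_left)
  qed
  note sum_eq = this[of n]
  have "sin (r * pi) = 0" using r by (metis sin_npi_int Ints_cases mult.commute)
  moreover have "A * (real n + 1/2 - node_shift c) =
     (if c = Cheb2 \<or> c = Cheb3 then r * pi - A/2 else r * pi)"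
    unfolding AN[symmetric] by (cases c) (auto simp: algebra_simps)
  ultimately have e1: "sin (A * (real n + 1/2 - node_shift c)) = (if c = Cheb2 \<or> c = Cheb3 then - cos (r * pi) * sin (A/2) else 0)"
    by (simp add: sin_diff)
  have e2: "sin (A * (1/2 - node_shift c)) = (if c = Cheb2 \<or> c = Cheb4 then sin (A/2) else 0)"
    by (cases c) auto
  have "sin (A/2) * (2 * (\<Sum>k=1..n. cos (A * (real k - node_shift c)))) =
    sin (A/2) * (- (if c = Cheb2 \<or> c = Cheb3 then cos (r * pi) else 0) - (if c = Cheb2 \<or> c = Cheb4 then 1 else 0))"
    using sum_eq unfolding e1 e2 by (cases c) (simp_all add: algebra_simps)
  then show ?thesis using s unfolding an by simp
qed

lemma mode_discrete_orthogonal: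
  assumes n: "n > 0" and ij: "i + j < 2 * n"
  shows "2 * mode_half c j * (\<Sum>k=1..n. cheb_mode c i (cheb_angle c n k) * cheb_mode c j (cheb_angle c n k)) =
    (if i = j then real n + freq_shift c else 0)"
proof -
  let ?S = "\<lambda>r. \<Sum>k=1..n. cos (r * cheb_angle c n k)"
  let ?r1 = "real i - real j" and ?r2 = "real i + real j + 2 * freq_shift c"
  have prod: "2 * (\<Sum>k=1..n. cheb_mode c i (cheb_angle c n k) * cheb_mode c j (cheb_angle c n k)) =
      ?S ?r1 + mode_sign c * ?S ?r2"
    by (simp add: sum_distrib_left cheb_mode_prod sum.distrib algebra_simps)
  have r: "?r1 \<in> \<int>" "?r2 \<in> \<int>" by (auto, cases c, auto intro!: Ints_add)
  have ij': "real i + real j < 2 * real n" using ij by linarith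
  have b: "\<bar>?r1\<bar> < 2 * (real n + freq_shift c)" "\<bar>?r2\<bar> < 2 * (real n + freq_shift c)"
    using freq_shift_bounds[of c] ij' by auto
  have "cos (?r2 * pi) = cos (?r1 * pi + 2 * (real j * pi) + 2 * freq_shift c * pi)"
    by (simp add: algebra_simps)
  also have "\<dots> = cos (?r1 * pi) * cos (2 * freq_shift c * pi)"
  proof -
    have "sin (2 * freq_shift c * pi) = 0" by (cases c) auto
    moreover have "cos (?r1 * pi + 2 * (real j * pi)) = cos (?r1 * pi)"
      using sin_2npi[of j] cos_2npi[of j] by (simp add: cos_add mult.assoc)
    ultimately show ?thesis by (simp add: cos_add)
  qed
  finally have c2: "cos (?r2 * pi) = cos (?r1 * pi) * cos (2 * freq_shift c * pi)" .
  show ?thesis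
  proof (cases "i = j")
    case False
    then have "?r1 \<noteq> 0" "?r2 \<noteq> 0" using freq_shift_bounds[of c] by auto
    then have "2 * (?S ?r1 + mode_sign c * ?S ?r2) = 0"
      using node_cos_sum[OF n r(1) _ b(1)] node_cos_sum[OF n r(2) _ b(2)] unfolding c2
      by (cases c) (auto simp: algebra_simps)
    then show ?thesis using prod False by (simp add: mult.assoc mult.left_commute)
  next
    case True
    have S1: "?S ?r1 = real n" using True by simp
    show ?thesis
    proof (cases "?r2 = 0")
      case r20: True
      then have "c = Cheb1" "i = 0" using True by (cases c; auto)+
      then show ?thesis using True by (simp add: mode_half_def)
    next
      case False
      then have "mode_half c j = 1" using True by (auto simp: mode_half_def)
      moreover have "2 * ?S ?r2 = - (if c = Cheb2 \<or> c = Cheb3 then cos (2 * freq_shift c * pi) else 0) - (if c = Cheb2 \<or> c = Cheb4 then 1 else 0)"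
        using node_cos_sum[OF n r(2) False b(2)] unfolding c2 using True by simp
      ultimately show ?thesis using prod S1 True by (cases c) (auto simp: mult.assoc)
    qed
  qed
qed

text \<open>This is Gauss quadrature with the nodes \<open>cos t\<^sub>k\<close>, which is exact up to degree \<open>2 n - 1\<close>,
  applied to products of two of the orthonormal polynomials.\<close>

lemma christoffel_orthogonal:
  assumes n: "n > 0" and ij: "i + j < 2 * n"
  shows "(\<Sum>k=1..n. christoffel c n k * poly (cheb_poly c i) (cheb_node c n k) * poly (cheb_poly c j) (cheb_node c n k)) =
    (if i = j then 1 else 0)"
proof -
  let ?N = "real n + freq_shift c" and ?W = "weight_const c * pi"
  let ?S = "\<Sum>k=1..n. cheb_mode c i (cheb_angle c n k) * cheb_mode c j (cheb_angle c n k)"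
  have N: "?N > 0" using n freq_shift_bounds[of c] by simp
  have "christoffel c n k * poly (cheb_poly c i) (cheb_node c n k) * poly (cheb_poly c j) (cheb_node c n k) =
     ?W * mode_norm c i * mode_norm c j / ?N * (cheb_mode c i (cheb_angle c n k) * cheb_mode c j (cheb_angle c n k))"
    if k: "k \<in> {1..n}" for k
  proof -
    have t: "0 < cheb_angle c n k" "cheb_angle c n k < pi" using cheb_angle_bounds k by auto
    show ?thesis using mode_denom_pos[OF t, of c] k N
      by (simp add: cheb_node_def christoffel_eq poly_cheb_cos[OF t] power2_eq_square)
  qed
  then have "(\<Sum>k=1..n. christoffel c n k * poly (cheb_poly c i) (cheb_node c n k) * poly (cheb_poly c j) (cheb_node c n k)) =
     ?W * mode_norm c i * mode_norm c j / ?N * ?S" by (simp add: sum_distrib_left)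
  also have "\<dots> = (if i = j then 1 else 0)"
  proof (cases "i = j")
    case True
    have e: "?W * mode_norm c i * mode_norm c j = 2 * mode_half c j"
      using mode_norm_sq[of c j] True by (simp add: power2_eq_square mult_ac)
    have "2 * mode_half c j / ?N * ?S = (2 * mode_half c j * ?S) / ?N" by simp
    also have "\<dots> = (if i = j then 1 else 0)"
      unfolding mode_discrete_orthogonal[OF n ij, of c] using True N by simp
    finally show ?thesis unfolding e .
  next
    case False
    have "mode_half c j \<noteq> 0" by (simp add: mode_half_def)
    then have "?S = 0" using mode_discrete_orthogonal[OF n ij, of c] False by simp
    then show ?thesis using False by simp
  qed
  finally show ?thesis .
qed

section \<open>Polynomial reproduction\<close>

text \<open>Degrees \<open>i \<le> n - m\<close> and \<open>j \<le> n + m - 1\<close> have \<open>i + j < 2 n\<close>, so the discrete orthogonality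
  relations pick out the single term \<open>j = i\<close>, whose coefficient \<open>\<mu>\<close> is \<open>1\<close>.\<close>

lemma vp_operator_reproduces:
  assumes "0 < m" "m < n" "degree P \<le> n - m"
  shows "vp_operator c n m (poly P) x = poly P x"
proof -
  let ?p = "cheb_poly c"
  have deg: "degree (?p j) = j" "lead_coeff (?p j) > 0" for j
    using cheb_explicit_orthonormal[of c] unfolding cheb_poly_eq orthonormal_system_def by blast+
  have lc: "lead_coeff (?p j) \<noteq> 0" for j using deg(2)[of j] by (metis less_irrefl)
  have "degree P < Suc (n - m)" using assms by simp
  then obtain a where a: "P = (\<Sum>i<Suc (n - m). smult (a i) (?p i))"
    using poly_expansion[of ?p P "Suc (n - m)", OF deg(1) lc] by metis
  have base: "vp_operator c n m (poly (?p i)) x = poly (?p i) x" if i: "i \<le> n - m" for i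
  proof -
    have "vp_operator c n m (poly (?p i)) x = (\<Sum>k=1..n. \<Sum>j=0..n+m-1. vp_coeff n m j * poly (?p j) x *
       (christoffel c n k * poly (?p i) (cheb_node c n k) * poly (?p j) (cheb_node c n k)))"
      unfolding vp_operator_def vp_fundamental_def
      by (intro sum.cong refl) (simp add: sum_distrib_left mult_ac)
    also have "\<dots> = (\<Sum>j=0..n+m-1. vp_coeff n m j * poly (?p j) x *
       (\<Sum>k=1..n. christoffel c n k * poly (?p i) (cheb_node c n k) * poly (?p j) (cheb_node c n k)))"
      by (subst sum.swap) (simp add: sum_distrib_left)
    also have "\<dots> = (\<Sum>j=0..n+m-1. if i = j then vp_coeff n m j * poly (?p j) x else 0)"
    proof (intro sum.cong refl)
      fix j assume "j \<in> {0..n+m-1}"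
      then have "i + j < 2 * n" using i assms by auto
      then show "vp_coeff n m j * poly (?p j) x *
       (\<Sum>k=1..n. christoffel c n k * poly (?p i) (cheb_node c n k) * poly (?p j) (cheb_node c n k)) = 
        (if i = j then vp_coeff n m j * poly (?p j) x else 0)"
        using christoffel_orthogonal[of n i j c] assms by simp
    qed
    also have "\<dots> = vp_coeff n m i * poly (?p i) x" using i assms by auto
    finally show ?thesis using i by (simp add: vp_coeff_def)
  qed
  have "vp_operator c n m (poly P) x = (\<Sum>i<Suc (n - m). a i * vp_operator c n m (poly (?p i)) x)"
    unfolding vp_operator_def sum_distrib_left
    by (subst sum.swap) (simp add: a poly_sum sum_distrib_left sum_distrib_right mult_ac del: sum.lessThan_Suc)
  also have "\<dots> = (\<Sum>i<Suc (n - m). a i * poly (?p i) x)" using base by (intro sum.cong) auto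
  also have "\<dots> = poly P x" by (simp add: a poly_sum)
  finally show ?thesis .
qed

lemma vp_operator_poly:
  "\<exists>Q. degree Q \<le> n + m - 1 \<and> (\<forall>x. vp_operator c n m f x = poly Q x)"
proof -
  define Q where "Q = (\<Sum>k=1..n. smult (f (cheb_node c n k) * christoffel c n k)
     (\<Sum>j=0..n+m-1. smult (vp_coeff n m j * poly (cheb_poly c j) (cheb_node c n k)) (cheb_poly c j)))"
  have deg: "degree (cheb_poly c j) = j" for j
    using cheb_explicit_orthonormal[of c] unfolding cheb_poly_eq orthonormal_system_def by blast
  have "degree Q \<le> n + m - 1" unfolding Q_def
    by (intro degree_sum_le order.trans[OF degree_smult_le]) (auto simp: deg)
  moreover have "vp_operator c n m f x = poly Q x" for x
    unfolding vp_operator_def vp_fundamental_def Q_def by (simp add: poly_sum mult_ac)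
  ultimately show ?thesis by blast
qed

section \<open>The de la Vallee Poussin kernel\<close>

definition vp_kernel :: "chebyshev_kind \<Rightarrow> nat \<Rightarrow> nat \<Rightarrow> real \<Rightarrow> real \<Rightarrow> real" where
  "vp_kernel c n m t s = (\<Sum>j<n+m. vp_coeff n m j * mode_half c j * (2 * (cheb_mode c j t * cheb_mode c j s)))"

lemma vp_fundamental_cos:
  assumes k: "1 \<le> k" "k \<le> n" and m: "m > 0" and t: "0 < t" "t < pi"
  shows "vp_fundamental c n m k (cos t) =
    mode_denom c (cheb_angle c n k) / mode_denom c t * vp_kernel c n m t (cheb_angle c n k) / (real n + freq_shift c)"
proof -
  let ?s = "cheb_angle c n k" and ?W = "weight_const c * pi" and ?N = "real n + freq_shift c"
  have s: "0 < ?s" "?s < pi" using cheb_angle_bounds[OF k] by auto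
  have d: "mode_denom c ?s > 0" "mode_denom c t > 0" using mode_denom_pos s t by auto
  have N: "?N > 0" using k freq_shift_bounds[of c] by simp
  have "christoffel c n k * (vp_coeff n m j * poly (cheb_poly c j) (cos t) * poly (cheb_poly c j) (cheb_node c n k)) =
     mode_denom c ?s / mode_denom c t / ?N * (vp_coeff n m j * mode_half c j * (2 * (cheb_mode c j t * cheb_mode c j ?s)))" for j
  proof -
    have "christoffel c n k * (vp_coeff n m j * poly (cheb_poly c j) (cos t) * poly (cheb_poly c j) (cheb_node c n k)) =
      (weight_const c * (mode_norm c j)\<^sup>2 * pi) * (mode_denom c ?s / mode_denom c t / ?N * vp_coeff n m j * (cheb_mode c j t * cheb_mode c j ?s))"
      unfolding christoffel_eq[OF k] cheb_node_def poly_cheb_cos[OF t] poly_cheb_cos[OF s]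
      using d N by (simp add: power2_eq_square mult_ac)
    then show ?thesis unfolding mode_norm_sq by simp
  qed
  moreover have "{0..n+m-1} = {..<n+m}" using m by auto
  ultimately show ?thesis
    unfolding vp_fundamental_def vp_kernel_def by (simp add: sum_distrib_left sum_distrib_right sum_divide_distrib mult_ac)
qed

text \<open>The kernel of the operator in the variable \<open>t\<close> is a sum or difference of two translates of this
  even function. For the second kind, the constant is the missing frequency \<open>0\<close>; it drops out of
  the difference, and with it the closed form below is the same in all four cases.\<close>

definition vp_profile :: "chebyshev_kind \<Rightarrow> nat \<Rightarrow> nat \<Rightarrow> real \<Rightarrow> real" where
  "vp_profile c n m \<theta> = (if c = Cheb2 then 1/2 else 0) +
     (\<Sum>j<n+m. vp_coeff n m j * (mode_half c j * cos ((real j + freq_shift c) * \<theta>)))"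

lemma vp_kernel_profile:
  "vp_kernel c n m t s = vp_profile c n m (t - s) + mode_sign c * vp_profile c n m (t + s)"
proof -
  have "vp_coeff n m j * mode_half c j * (2 * (cheb_mode c j t * cheb_mode c j s)) =
    vp_coeff n m j * (mode_half c j * cos ((real j + freq_shift c) * (t - s))) +
    mode_sign c * (vp_coeff n m j * (mode_half c j * cos ((real j + freq_shift c) * (t + s))))" for j
    unfolding cheb_mode_prod by (simp add: distrib_left right_diff_distrib)
  then show ?thesis
    unfolding vp_kernel_def vp_profile_def by (cases c) (simp_all add: sum.distrib sum_subtractf sum_distrib_left[symmetric])
qed

lemma vp_profile_closed:
  assumes "0 < m" "m < n"
  shows "4 * real m * (sin (\<theta>/2))\<^sup>2 * vp_profile c n m \<theta> = sin ((real n + freq_shift c) * \<theta>) * sin (real m * \<theta>)"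
proof -
  let ?q = "\<lambda>j. mode_half c j * cos ((real j + freq_shift c) * \<theta>)"
  let ?s = "sin (\<theta>/2)" and ?x = "(real n + freq_shift c) * \<theta>" and ?y = "real m * \<theta>"
  let ?F = "\<lambda>M. \<Sum>j<M. real (M - j) * ?q j"
  let ?S = "\<Sum>j<n+m. vp_coeff n m j * ?q j"
  \<comment> \<open>The trapezoidal coefficients are a difference of two truncated linear functions (truncated
    subtraction of natural numbers is intended).\<close>
  have co: "2 * real m * vp_coeff n m j = real (n + m - j) - real (n - m - j)" if "j < n + m" for j
  proof (cases "j \<le> n - m")
    case True
    then have "j + m \<le> n" using assms by simp
    then show ?thesis using True assms by (simp add: vp_coeff_def of_nat_diff)
  next
    case False
    then show ?thesis using that assms by (simp add: vp_coeff_def of_nat_diff)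
  qed
  have "2 * real m * ?S = (\<Sum>j<n+m. (real (n + m - j) - real (n - m - j)) * ?q j)"
    unfolding sum_distrib_left by (intro sum.cong refl) (use co in \<open>simp add: mult.assoc[symmetric]\<close>)
  also have "\<dots> = ?F (n + m) - (\<Sum>j<n+m. real (n - m - j) * ?q j)"
    by (simp add: left_diff_distrib sum_subtractf)
  also have "(\<Sum>j<n+m. real (n - m - j) * ?q j) = ?F (n - m)"
    by (intro sum.mono_neutral_right) auto
  finally have "4 * ?s\<^sup>2 * (2 * real m * ?S) = 4 * ?s\<^sup>2 * ?F (n + m) - 4 * ?s\<^sup>2 * ?F (n - m)"
    by (simp add: right_diff_distrib)
  also have "\<dots> = cos ((real (n - m) + freq_shift c) * \<theta>) - cos ((real (n + m) + freq_shift c) * \<theta>)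
      - (if c = Cheb2 then 4 * real m * ?s\<^sup>2 else 0)"
    unfolding fejer_closed using assms by (simp add: of_nat_diff algebra_simps)
  also have "(real (n - m) + freq_shift c) * \<theta> = ?x - ?y" using assms by (simp add: of_nat_diff algebra_simps)
  also have "(real (n + m) + freq_shift c) * \<theta> = ?x + ?y" by (simp add: algebra_simps)
  also have "cos (?x - ?y) - cos (?x + ?y) = 2 * sin ?x * sin ?y" by (simp add: cos_add cos_diff)
  finally show ?thesis unfolding vp_profile_def by (cases "c = Cheb2") (simp_all add: algebra_simps)
qed

text \<open>The nodes are the zeros of the \<open>n\<close>-th mode, so translating the sine of frequency \<open>N\<close> by a node
  produces that mode up to sign, and a bound on the mode at \<open>t\<close> is a bound on both parts of the kernel.\<close>

lemma abs_sin_node: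
  assumes "n > 0"
  shows "\<bar>sin ((real n + freq_shift c) * (t - cheb_angle c n k))\<bar> = \<bar>cheb_mode c n t\<bar>"
    and "\<bar>sin ((real n + freq_shift c) * (t + cheb_angle c n k))\<bar> = \<bar>cheb_mode c n t\<bar>"
proof -
  let ?N = "real n + freq_shift c" and ?y = "(real k - node_shift c) * pi"
  have y: "sin ?y = 0 \<and> \<bar>cos ?y\<bar> = 1" if "mode_sign c = -1"
    using that sin_npi[of k] cos_npi[of k] by (cases c) auto
  have y': "cos ?y = 0 \<and> \<bar>sin ?y\<bar> = 1" if "mode_sign c = 1"
  proof -
    have "?y = real k * pi - pi/2" using that by (cases c) (auto simp: left_diff_distrib)
    then show ?thesis using sin_npi[of k] cos_npi[of k] by (simp add: cos_diff sin_diff)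
  qed
  have e: "?N * (t - cheb_angle c n k) = ?N * t - ?y" "?N * (t + cheb_angle c n k) = ?N * t + ?y"
    using freq_times_angle[OF assms, of c k] by (simp_all add: algebra_simps)
  have "mode_sign c = 1 \<or> mode_sign c = -1" by (cases c) auto
  then show "\<bar>sin (?N * (t - cheb_angle c n k))\<bar> = \<bar>cheb_mode c n t\<bar>"
    "\<bar>sin (?N * (t + cheb_angle c n k))\<bar> = \<bar>cheb_mode c n t\<bar>"
    unfolding e cheb_mode_alt using y y' by (auto simp: sin_add sin_diff abs_mult)
qed

lemma vp_coeff_bounds:
  assumes "0 < m" "m < n" "j < n + m"
  shows "0 \<le> vp_coeff n m j" "vp_coeff n m j \<le> 1"
  using assms by (auto simp: vp_coeff_def field_simps of_nat_diff)

text \<open>Away from the diagonal the closed form of the profile gives the bound \<open>H / (2 m d\<^sup>2)\<close>, where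
  \<open>d = \<bar>sin ((t - t\<^sub>k) / 2)\<bar>\<close>; near it, counting terms gives \<open>4 N H\<close>. As \<open>n \<le> C0 m\<close>, the two combine
  to quadratic decay on the scale \<open>1 / N\<close>. The bound \<open>H\<close> on the modes is kept as a parameter because
  the smallness of the sine modes near an endpoint has to be passed on to the kernel.\<close>

lemma vp_kernel_bound:
  assumes m: "0 < m" "m < n" and C0: "real n \<le> C0 * real m" "C0 > 1"
    and t: "0 \<le> t" "t \<le> pi" and k: "1 \<le> k" "k \<le> n"
    and H: "\<And>j. j < n + m \<Longrightarrow> \<bar>cheb_mode c j t\<bar> \<le> H"
  shows "\<bar>vp_kernel c n m t (cheb_angle c n k)\<bar> \<le>
    16 * C0 * (real n + freq_shift c) * H / (1 + (real n + freq_shift c) * \<bar>sin ((t - cheb_angle c n k) / 2)\<bar>)\<^sup>2"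
proof -
  let ?N = "real n + freq_shift c" and ?s = "cheb_angle c n k"
  let ?K = "vp_kernel c n m t ?s"
  define d where "d = \<bar>sin ((t - ?s) / 2)\<bar>"
  have N: "?N \<ge> 1" "real n \<le> ?N" "?N \<le> 2 * real n" using k freq_shift_bounds[of c] by auto
  have H0: "H \<ge> 0" using order.trans[OF abs_ge_zero H[of 0]] m by simp
  have K1: "\<bar>?K\<bar> \<le> 4 * ?N * H"
  proof -
    have "\<bar>?K\<bar> \<le> (\<Sum>j<n+m. \<bar>vp_coeff n m j * mode_half c j * (2 * (cheb_mode c j t * cheb_mode c j ?s))\<bar>)"
      unfolding vp_kernel_def by (rule sum_abs)
    also have "\<dots> \<le> (\<Sum>j<n+m. 2 * H)"
    proof (intro sum_mono)
      fix j assume "j \<in> {..<n+m}"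
      then have j: "j < n + m" by simp
      have "\<bar>cheb_mode c j ?s\<bar> \<le> 1" by (simp add: cheb_mode_alt)
      then have "\<bar>cheb_mode c j t\<bar> * \<bar>cheb_mode c j ?s\<bar> \<le> H * 1" using H[OF j] H0 by (intro mult_mono) auto
      moreover have "\<bar>vp_coeff n m j\<bar> * \<bar>mode_half c j\<bar> \<le> 1 * 1"
        using vp_coeff_bounds[OF m j] by (intro mult_mono) (auto simp: mode_half_def)
      ultimately have "(\<bar>vp_coeff n m j\<bar> * \<bar>mode_half c j\<bar>) * (\<bar>cheb_mode c j t\<bar> * \<bar>cheb_mode c j ?s\<bar>) \<le> 1 * H"
        by (intro mult_mono) auto
      then show "\<bar>vp_coeff n m j * mode_half c j * (2 * (cheb_mode c j t * cheb_mode c j ?s))\<bar> \<le> 2 * H"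
        by (simp add: abs_mult)
    qed
    also have "\<dots> = 2 * real (n + m) * H" by simp
    also have "\<dots> \<le> 4 * ?N * H" using H0 m N by (intro mult_right_mono) auto
    finally show ?thesis .
  qed
  have K2: "\<bar>?K\<bar> * (2 * real m * d\<^sup>2) \<le> H"
  proof (cases "d = 0")
    case True then show ?thesis using H0 by simp
  next
    case False
    have d2: "d\<^sup>2 = (sin ((t - ?s) / 2))\<^sup>2" by (simp add: d_def)
    have s: "0 < ?s" "?s < pi" using cheb_angle_bounds[OF k] by auto
    have "(sin ((t + ?s) / 2))\<^sup>2 - (sin ((t - ?s) / 2))\<^sup>2 = sin t * sin ?s"
    proof -
      have "sin t * sin ?s = (cos (t - ?s) - cos (t + ?s)) / 2" by (rule sin_times_sin)
      then show ?thesis using cos_double_half(2)[of "t - ?s"] cos_double_half(2)[of "t + ?s"] by simp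
    qed
    moreover have "sin t * sin ?s \<ge> 0" using t s by (intro mult_nonneg_nonneg sin_ge_zero) auto
    \<comment> \<open>The reflected translate has the larger sine, so it obeys the bound in \<open>d\<close> as well.\<close>
    ultimately have dp: "d\<^sup>2 \<le> (sin ((t + ?s) / 2))\<^sup>2" by (simp add: d2)
    have P: "\<bar>vp_profile c n m \<theta>\<bar> * (4 * real m * (sin (\<theta>/2))\<^sup>2) \<le> H"
      if "\<bar>sin (?N * \<theta>)\<bar> = \<bar>cheb_mode c n t\<bar>" for \<theta>
    proof -
      have "\<bar>vp_profile c n m \<theta>\<bar> * (4 * real m * (sin (\<theta>/2))\<^sup>2) = \<bar>4 * real m * (sin (\<theta>/2))\<^sup>2 * vp_profile c n m \<theta>\<bar>"
        by (simp add: abs_mult)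
      also have "\<dots> = \<bar>cheb_mode c n t\<bar> * \<bar>sin (real m * \<theta>)\<bar>"
        unfolding vp_profile_closed[OF m] by (simp add: abs_mult that)
      also have "\<dots> \<le> H * 1" using H[of n] m H0 by (intro mult_mono) auto
      finally show ?thesis by simp
    qed
    have P1: "\<bar>vp_profile c n m (t - ?s)\<bar> * (4 * real m * d\<^sup>2) \<le> H"
      unfolding d2 using m by (intro P abs_sin_node) simp
    have "\<bar>vp_profile c n m (t + ?s)\<bar> * (4 * real m * d\<^sup>2) \<le> \<bar>vp_profile c n m (t + ?s)\<bar> * (4 * real m * (sin ((t + ?s) / 2))\<^sup>2)"
      using dp by (intro mult_left_mono) auto
    also have "\<dots> \<le> H" using m by (intro P abs_sin_node) simp
    finally have P2: "\<bar>vp_profile c n m (t + ?s)\<bar> * (4 * real m * d\<^sup>2) \<le> H" .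
    have "\<bar>?K\<bar> \<le> \<bar>vp_profile c n m (t - ?s)\<bar> + \<bar>vp_profile c n m (t + ?s)\<bar>"
      unfolding vp_kernel_profile by (cases c) auto
    then have "\<bar>?K\<bar> * (4 * real m * d\<^sup>2) \<le> (\<bar>vp_profile c n m (t - ?s)\<bar> + \<bar>vp_profile c n m (t + ?s)\<bar>) * (4 * real m * d\<^sup>2)"
      by (intro mult_right_mono) auto
    then have "\<bar>?K\<bar> * (4 * real m * d\<^sup>2) \<le> H + H" using P1 P2 by (simp only: distrib_right)
    then show ?thesis by (simp add: mult_ac)
  qed
  have "\<bar>?K\<bar> * (1 + ?N * d)\<^sup>2 \<le> 16 * C0 * ?N * H"
  proof (cases "?N * d \<le> 1")
    case True
    have "(1 + ?N * d)\<^sup>2 \<le> 2\<^sup>2" using True N by (intro power_mono) (auto simp: d_def)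
    then have "\<bar>?K\<bar> * (1 + ?N * d)\<^sup>2 \<le> (4 * ?N * H) * 2\<^sup>2" using K1 by (intro mult_mono) auto
    also have "\<dots> = 16 * 1 * ?N * H" by simp
    also have "\<dots> \<le> 16 * C0 * ?N * H" using C0 N H0 by (intro mult_right_mono) auto
    finally show ?thesis .
  next
    case False
    have "(1 + ?N * d)\<^sup>2 \<le> (2 * (?N * d))\<^sup>2" using False by (intro power_mono) linarith+
    also have "\<dots> = 2 * ?N * (2 * ?N) * d\<^sup>2" by (simp only: power2_eq_square mult_ac)
    also have "\<dots> \<le> 2 * ?N * (4 * (C0 * real m)) * d\<^sup>2" using N C0 by (intro mult_right_mono mult_left_mono) auto
    also have "\<dots> = 4 * C0 * ?N * (2 * real m * d\<^sup>2)" by simp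
    finally have "\<bar>?K\<bar> * (1 + ?N * d)\<^sup>2 \<le> \<bar>?K\<bar> * (4 * C0 * ?N * (2 * real m * d\<^sup>2))"
      by (intro mult_left_mono) auto
    also have "\<dots> = 4 * C0 * ?N * (\<bar>?K\<bar> * (2 * real m * d\<^sup>2))" by simp
    also have "\<dots> \<le> 4 * C0 * ?N * H" using K2 C0 N by (intro mult_left_mono) auto
    also have "\<dots> \<le> 16 * C0 * ?N * H" using C0 N H0 by (intro mult_right_mono) auto
    finally show ?thesis .
  qed
  moreover have "(1 + ?N * d)\<^sup>2 > 0" using N by (intro zero_less_power add_pos_nonneg) (auto simp: d_def)
  ultimately show ?thesis unfolding d_def[symmetric] by (simp add: pos_le_divide_eq)
qed

lemma abs_sin_mult_le: "\<bar>sin (real q * x)\<bar> \<le> real q * \<bar>sin x\<bar>"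
proof (induction q)
  case 0 then show ?case by simp
next
  case (Suc q)
  have "\<bar>sin (real (Suc q) * x)\<bar> = \<bar>sin (real q * x) * cos x + cos (real q * x) * sin x\<bar>"
  proof -
    have "real (Suc q) * x = real q * x + x" by (simp add: algebra_simps)
    then show ?thesis by (simp only: sin_add)
  qed
  also have "\<dots> \<le> \<bar>sin (real q * x)\<bar> * \<bar>cos x\<bar> + \<bar>cos (real q * x)\<bar> * \<bar>sin x\<bar>"
    unfolding abs_mult[symmetric] by (rule abs_triangle_ineq)
  also have "\<dots> \<le> \<bar>sin (real q * x)\<bar> * 1 + 1 * \<bar>sin x\<bar>"
    by (intro add_mono mult_mono) auto
  finally show ?case using Suc by (simp add: distrib_right)
qed

definition vanishes_at_0 :: "chebyshev_kind \<Rightarrow> bool" where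
  "vanishes_at_0 c \<longleftrightarrow> c = Cheb2 \<or> c = Cheb4"

definition vanishes_at_pi :: "chebyshev_kind \<Rightarrow> bool" where
  "vanishes_at_pi c \<longleftrightarrow> c = Cheb2 \<or> c = Cheb3"

text \<open>Near an endpoint where they vanish, modes are bounded by frequency times the distance.\<close>

lemma cheb_mode_vanish_0:
  assumes "vanishes_at_0 c" "0 \<le> t" "t \<le> pi"
  shows "\<bar>cheb_mode c j t\<bar> \<le> 2 * (real j + freq_shift c) * sin (t/2)"
proof -
  have s: "sin (t/2) \<ge> 0" using assms by (intro sin_ge_zero) auto
  have "(real j + 1) * t = real (2 * j + 2) * (t/2)" "(real j + 1/2) * t = real (2 * j + 1) * (t/2)"
    by (simp_all add: field_simps)
  then show ?thesis
    using assms(1) abs_sin_mult_le[of "2*j+2" "t/2"] abs_sin_mult_le[of "2*j+1" "t/2"] s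
    by (auto simp: vanishes_at_0_def algebra_simps)
qed

lemma cheb_mode_vanish_pi:
  assumes "vanishes_at_pi c" "0 \<le> t" "t \<le> pi"
  shows "\<bar>cheb_mode c j t\<bar> \<le> 2 * (real j + freq_shift c) * cos (t/2)"
proof -
  \<comment> \<open>Half the distance from the endpoint \<open>\<pi>\<close>.\<close>
  define x where "x = pi/2 - t/2"
  have sx: "sin x = cos (t/2)" "sin x \<ge> 0" using assms by (auto simp: x_def sin_diff intro!: cos_ge_zero)
  have t: "t = pi - 2 * x" by (simp add: x_def)
  have "\<bar>sin ((real j + 1) * t)\<bar> = \<bar>sin (real (2 * j + 2) * x)\<bar>"
  proof -
    have "(real j + 1) * t = real (Suc j) * pi - real (2 * j + 2) * x" unfolding t by (simp add: algebra_simps)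
    then show ?thesis using sin_npi[of "Suc j"] cos_npi[of "Suc j"] by (simp only: sin_diff) (simp add: abs_mult)
  qed
  moreover have "\<bar>cos ((real j + 1/2) * t)\<bar> = \<bar>sin (real (2 * j + 1) * x)\<bar>"
  proof -
    have "(real j + 1/2) * t = (real j * pi + pi/2) - real (2 * j + 1) * x" unfolding t by (simp add: algebra_simps)
    then show ?thesis using sin_npi[of j] cos_npi[of j]
      by (simp only: cos_diff cos_add sin_add) (simp add: abs_mult)
  qed
  ultimately show ?thesis
    using assms(1) abs_sin_mult_le[of "2*j+2" x] abs_sin_mult_le[of "2*j+1" x] sx
    by (auto simp: vanishes_at_pi_def algebra_simps)
qed

text \<open>In addition to the decay, the kernel gains the factor \<open>N sin (t/2)\<close> within distance \<open>1 / N\<close> of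
  the endpoint \<open>0\<close> if the modes vanish there, and likewise at \<open>\<pi>\<close>. This compensates a singular
  weight ratio \<open>(sin (t/2) / sin (t\<^sub>k/2)) powr \<alpha>\<close> with \<open>\<alpha> < 0\<close>.\<close>

lemma vp_kernel_gain:
  assumes m: "0 < m" "m < n" and C0: "real n \<le> C0 * real m" "C0 > 1"
    and t: "0 \<le> t" "t \<le> pi" and k: "1 \<le> k" "k \<le> n"
    and H: "H = 1 \<or> vanishes_at_0 c \<and> H = min 1 ((real n + freq_shift c) * sin (t/2)) \<or>
            vanishes_at_pi c \<and> H = min 1 ((real n + freq_shift c) * cos (t/2))"
  shows "\<bar>vp_kernel c n m t (cheb_angle c n k)\<bar> \<le>
    64 * C0 * (real n + freq_shift c) * (H / (1 + (real n + freq_shift c) * \<bar>sin ((t - cheb_angle c n k) / 2)\<bar>)\<^sup>2)"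
proof -
  let ?N = "real n + freq_shift c"
  have nn: "sin (t/2) \<ge> 0" "cos (t/2) \<ge> 0" using t by (auto intro!: sin_ge_zero cos_ge_zero)
  have one: "\<bar>cheb_mode c j t\<bar> \<le> 1" for j by (simp add: cheb_mode_alt)
  have min4: "y \<le> 1 \<Longrightarrow> y \<le> 4 * z \<Longrightarrow> y \<le> 4 * min 1 z" for y z :: real by (auto simp: min_def)
  have gen: "\<bar>cheb_mode c j t\<bar> \<le> 4 * min 1 (?N * g)"
    if j: "j < n + m" and g: "g \<ge> 0" "\<bar>cheb_mode c j t\<bar> \<le> 2 * (real j + freq_shift c) * g" for j g
  proof -
    have "real j + 1 \<le> 2 * real n" using j m by linarith
    then have "real j + freq_shift c \<le> 2 * ?N" using freq_shift_bounds[of c] by simp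
    then have "2 * (real j + freq_shift c) * g \<le> (4 * ?N) * g" using g by (intro mult_right_mono) auto
    then have "\<bar>cheb_mode c j t\<bar> \<le> 4 * (?N * g)" using g(2) by (simp only: mult.assoc)
    then show ?thesis using one[of j] by (rule min4[rotated])
  qed
  have "\<bar>cheb_mode c j t\<bar> \<le> 4 * H" if j: "j < n + m" for j
    using H gen[OF j nn(1)] gen[OF j nn(2)] cheb_mode_vanish_0[OF _ t, of c j] cheb_mode_vanish_pi[OF _ t, of c j] one[of j] by auto
  from vp_kernel_bound[OF m C0 t k this] show ?thesis by simp
qed

section \<open>The weight ratio against the kernel\<close>

text \<open>The central estimate, in the situation where the first ratio is at most \<open>1\<close> and the second one at
  least \<open>1\<close>. Put \<open>e = max 0 (-\<alpha>)\<close> and \<open>p = 2 - e\<close>. The first power is at most \<open>(a' / a) powr e\<close>,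
  and multiplied by the gain it is at most \<open>(1 + N d) powr e\<close>. The second power is at most
  \<open>(1 + d / b') powr p\<close>, by \<open>\<beta> \<le> p\<close>, which is what the hypotheses \<open>\<beta> \<le> 2\<close> and \<open>\<beta> - \<alpha> \<le> 2\<close> say.
  Since \<open>e - 2 = - p\<close>, everything is at most the \<open>p\<close>-th power of \<open>(1 + d / b') / (1 + N d)\<close>, and this
  quotient is at most \<open>1 / (1 + N d) + 1 / (N b')\<close>. The condition \<open>-1 < \<alpha>\<close> makes \<open>p > 1\<close>, so that
  both terms can be summed over the nodes.\<close>

lemma ratio_kernel_bound:
  fixes a b a' b' d N \<alpha> \<beta> :: real
  assumes pos: "0 < a" "0 < b" "0 < a'" "0 < b'" "0 < N" "0 \<le> d"
    and le: "a \<le> a'" "b' \<le> b" "a' \<le> a + d" "b \<le> b' + d"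
    and ex: "-1 < \<alpha>" "\<beta> \<le> 2" "\<beta> - \<alpha> \<le> 2"
  shows "(a / a') powr \<alpha> * (b / b') powr \<beta> * ((if \<alpha> < 0 then min 1 (N * a) else 1) / (1 + N * d)\<^sup>2) \<le>
     4 * ((1 + N * d) powr (- (2 - max 0 (-\<alpha>))) + (N * b') powr (- (2 - max 0 (-\<alpha>))))"
proof -
  define e where "e = max 0 (-\<alpha>)"
  define p where "p = 2 - e"
  define H where "H = (if \<alpha> < 0 then min 1 (N * a) else 1)"
  define X where "X = 1 + N * d"
  have e: "0 \<le> e" "e < 1" "- e \<le> \<alpha>" "\<beta> \<le> p" using ex by (auto simp: e_def p_def)
  have p: "0 < p" "p \<le> 2" using e by (auto simp: p_def)
  have X: "X \<ge> 1" using pos by (simp add: X_def)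
  have 1: "(a / a') powr \<alpha> * H \<le> X powr e"
  proof (cases "\<alpha> < 0")
    case False
    then have "e = 0" "H = 1" by (auto simp: e_def H_def)
    moreover have "(a / a') powr \<alpha> \<le> 1" using pos le False by (intro powr_le1) auto
    ultimately show ?thesis using X by simp
  next
    case True
    then have ea: "\<alpha> = - e" and H: "H = min 1 (N * a)" by (auto simp: e_def H_def)
    have H01: "0 < H" "H \<le> 1" using pos by (auto simp: H)
    \<comment> \<open>One may pass from \<open>H\<close> to its power \<open>e < 1\<close>, which matches that of \<open>a' / a\<close>.\<close>
    have "H powr 1 \<le> H powr e" using H01 e by (intro powr_mono') auto
    then have He: "H \<le> H powr e" using H01 by simp
    \<comment> \<open>This is where the gain enters: \<open>H\<close> replaces the factor \<open>1 / a\<close> by \<open>min (1 / a) N\<close>.\<close>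
    have aa: "a' / a * H \<le> X"
    proof (cases "N * a \<le> 1")
      case True
      then have "a' / a * H = N * a'" using pos by (simp add: H)
      also have "\<dots> \<le> N * (a + d)" using le pos by (intro mult_left_mono) auto
      finally show ?thesis using True by (simp add: X_def distrib_left)
    next
      case False
      then have "a' / a * H = a' / a" by (simp add: H)
      also have "\<dots> \<le> (a + d) / a" using le pos by (intro divide_right_mono) auto
      also have "\<dots> = 1 + d * (1 / a)" using pos by (simp add: add_divide_distrib)
      also have "d * (1 / a) \<le> d * N" using False pos by (intro mult_left_mono) (auto simp: field_simps)
      finally show ?thesis by (simp add: X_def mult.commute)
    qed
    have "(a / a') powr \<alpha> = (a' / a) powr e" using pos by (simp add: ea powr_minus powr_divide field_simps)
    then have "(a / a') powr \<alpha> * H \<le> (a' / a) powr e * H powr e" using He by (simp add: mult_left_mono)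
    also have "\<dots> = (a' / a * H) powr e" using pos H01 by (intro powr_mult[symmetric])
    also have "\<dots> \<le> X powr e" using aa pos H01 e by (intro powr_mono2) auto
    finally show ?thesis .
  qed
  have 2: "(b / b') powr \<beta> \<le> (1 + d / b') powr p"
  proof -
    have "(b / b') powr \<beta> \<le> (b / b') powr p" using e pos le by (intro powr_mono) auto
    also have "\<dots> \<le> (1 + d / b') powr p"
      using p pos le by (intro powr_mono2) (auto simp: field_simps)
    finally show ?thesis .
  qed
  have X2: "X powr e / X\<^sup>2 = X powr (-p)"
  proof -
    have "X\<^sup>2 = X powr 2" using X by simp
    then show ?thesis unfolding p_def by (simp add: powr_diff[symmetric])
  qed
  \<comment> \<open>A sum of two numbers is at most twice their maximum \<open>M\<close>, whose power is one of the two powers.\<close>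
  define M where "M = max (1 / X) (1 / (N * b'))"
  have M0: "M > 0" using X by (auto simp: M_def less_max_iff_disj)
  have dX: "d / X \<le> 1 / N"
  proof -
    have "d * N \<le> X" by (simp add: X_def)
    then have "d \<le> X / N" using pos by (simp add: pos_le_divide_eq)
    then have "d / X \<le> X / N / X" using X by (intro divide_right_mono) auto
    then show ?thesis using X by simp
  qed
  have "(1 + d / b') / X = 1 / X + d / X * (1 / b')" by (simp add: add_divide_distrib)
  also have "1 / X + d / X * (1 / b') \<le> 1 / X + 1 / N * (1 / b')" using pos dX by (intro add_left_mono mult_right_mono) auto
  also have "\<dots> \<le> 2 * M" by (simp add: M_def)
  finally have Mb: "(1 + d / b') / X \<le> 2 * M" .
  have "(a / a') powr \<alpha> * (b / b') powr \<beta> * (H / X\<^sup>2) = ((a / a') powr \<alpha> * H) * (b / b') powr \<beta> / X\<^sup>2" by simp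
  also have "\<dots> \<le> X powr e * (1 + d / b') powr p / X\<^sup>2"
    using 1 2 by (intro divide_right_mono mult_mono) auto
  also have "\<dots> = (1 + d / b') powr p * (X powr e / X\<^sup>2)" by simp
  also have "\<dots> = ((1 + d / b') / X) powr p"
    unfolding X2 using X pos by (simp add: powr_minus_divide powr_divide)
  also have "\<dots> \<le> (2 * M) powr p" using Mb p X pos by (intro powr_mono2) auto
  also have "\<dots> = 2 powr p * M powr p" using M0 by (simp add: powr_mult)
  also have "\<dots> \<le> 2 powr 2 * ((1 / X) powr p + (1 / (N * b')) powr p)"
    by (intro mult_mono powr_mono) (use p in \<open>auto simp: M_def max_def\<close>)
  also have "(1 / X) powr p = X powr (-p)" using X by (simp add: powr_minus_divide powr_divide)
  also have "(1 / (N * b')) powr p = (N * b') powr (-p)" using pos by (simp add: powr_minus_divide powr_divide)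
  finally show ?thesis by (simp add: H_def X_def p_def e_def)
qed

section \<open>Sums over the nodes\<close>

text \<open>On \<open>[0, \<pi>/2]\<close> the concave function \<open>sin\<close> lies above its chord.\<close>

lemma sin_ge_chord: "0 \<le> x \<Longrightarrow> x \<le> pi/2 \<Longrightarrow> 2 * x / pi \<le> sin x"
proof -
  assume x: "0 \<le> x" "x \<le> pi/2"
  have "convex_on {0..pi/2} (\<lambda>x. - sin x)"
  proof (rule f''_ge0_imp_convex)
    show "((\<lambda>x. - sin x) has_real_derivative - cos x) (at x)" for x :: real by (auto intro!: derivative_eq_intros)
    show "((\<lambda>x. - cos x) has_real_derivative sin x) (at x)" for x :: real by (auto intro!: derivative_eq_intros)
    show "sin x \<ge> 0" if "x \<in> {0..pi/2}" for x :: real using that by (auto intro!: sin_ge_zero)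
  qed auto
  from convex_onD[OF this, of "2 * x / pi" 0 "pi/2"] x show ?thesis by (simp add: field_simps)
qed

lemma abs_sin_half_ge: "\<bar>x\<bar> \<le> pi \<Longrightarrow> \<bar>x\<bar> / pi \<le> \<bar>sin (x/2)\<bar>"
  using sin_ge_chord[of "\<bar>x\<bar>/2"] by (auto simp: abs_if split: if_splits)

text \<open>The value \<open>\<zeta>(p)\<close>.\<close>

definition power_sum :: "real \<Rightarrow> real" where
  "power_sum p = (\<Sum>i. (1 + real i) powr (-p))"

lemma power_sum_le:
  assumes "p > 1" "finite I"
  shows "(\<Sum>i\<in>I. (1 + real i) powr (-p)) \<le> power_sum p"
proof -
  have "summable (\<lambda>i. real i powr (-p))" using assms by (simp add: summable_real_powr_iff)
  then have "summable (\<lambda>i. real (Suc i) powr (-p))" by (subst summable_Suc_iff)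
  then have "summable (\<lambda>i. (1 + real i) powr (-p))" by simp
  then show ?thesis unfolding power_sum_def by (rule sum_le_suminf) (use assms in auto)
qed

lemma sum_powr_inj_le:
  assumes p: "p > 1" and I: "finite I" "inj_on h I" and h: "\<And>k. k \<in> I \<Longrightarrow> 1 + real (h k) \<le> g k"
  shows "(\<Sum>k\<in>I. g k powr (-p)) \<le> power_sum p"
proof -
  have "(\<Sum>k\<in>I. g k powr (-p)) \<le> (\<Sum>k\<in>I. (1 + real (h k)) powr (-p))"
    using h p by (intro sum_mono powr_mono2') auto
  also have "\<dots> = (\<Sum>i\<in>h ` I. (1 + real i) powr (-p))" using I by (simp add: sum.reindex)
  also have "\<dots> \<le> power_sum p" using p I by (intro power_sum_le) auto
  finally show ?thesis .
qed

text \<open>The integers on either side of \<open>y\<close> have distances at least \<open>0, 1, 2, \<dots>\<close> from \<open>y\<close>.\<close>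

lemma sum_shifted_le:
  assumes p: "p > 1"
  shows "(\<Sum>k=1..n. (1 + \<bar>y - real k\<bar>) powr (-p)) \<le> 2 * power_sum p"
proof -
  let ?A = "{k \<in> {1..n}. real k \<le> y}" and ?B = "{k \<in> {1..n}. \<not> real k \<le> y}"
  let ?z = "\<lfloor>y\<rfloor>"
  have "(\<Sum>k\<in>?A. (1 + \<bar>y - real k\<bar>) powr (-p)) \<le> power_sum p"
  proof (rule sum_powr_inj_le[OF p, where h = "\<lambda>k. nat (?z - int k)"])
    have le: "int k \<le> ?z" if "k \<in> ?A" for k using that by (simp add: le_floor_iff)
    show "inj_on (\<lambda>k. nat (?z - int k)) ?A"
    proof (rule inj_onI)
      fix k l assume "k \<in> ?A" "l \<in> ?A" "nat (?z - int k) = nat (?z - int l)"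
      then show "k = l" using le[of k] le[of l] by (simp add: eq_nat_nat_iff)
    qed
    fix k assume k: "k \<in> ?A"
    then have "real (nat (?z - int k)) = of_int ?z - real k" using le[OF k] by simp
    then show "1 + real (nat (?z - int k)) \<le> 1 + \<bar>y - real k\<bar>" using of_int_floor_le[of y] by linarith
  qed auto
  moreover have "(\<Sum>k\<in>?B. (1 + \<bar>y - real k\<bar>) powr (-p)) \<le> power_sum p"
  proof (rule sum_powr_inj_le[OF p, where h = "\<lambda>k. nat (int k - ?z - 1)"])
    have le: "?z + 1 \<le> int k" if "k \<in> ?B" for k using that by (simp add: not_le) linarith
    show "inj_on (\<lambda>k. nat (int k - ?z - 1)) ?B"
    proof (rule inj_onI)
      fix k l assume "k \<in> ?B" "l \<in> ?B" "nat (int k - ?z - 1) = nat (int l - ?z - 1)"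
      then show "k = l" using le[of k] le[of l] by (simp add: eq_nat_nat_iff)
    qed
    fix k assume k: "k \<in> ?B"
    then have "real (nat (int k - ?z - 1)) = real k - of_int ?z - 1" using le[OF k] by simp
    then show "1 + real (nat (int k - ?z - 1)) \<le> 1 + \<bar>y - real k\<bar>" using k by (simp add: not_le) linarith
  qed auto
  moreover have "(\<Sum>k=1..n. (1 + \<bar>y - real k\<bar>) powr (-p)) =
     (\<Sum>k\<in>?A. (1 + \<bar>y - real k\<bar>) powr (-p)) + (\<Sum>k\<in>?B. (1 + \<bar>y - real k\<bar>) powr (-p))"
    by (subst sum.union_disjoint[symmetric]) (auto intro!: sum.cong)
  ultimately show ?thesis by simp
qed

text \<open>The nodes have the spacing \<open>\<pi> / N\<close>, and the \<open>k\<close>-th node from either end has distance at least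
  \<open>k \<pi> / (2 N)\<close> from it, so the three sums are comparable to \<open>\<zeta>(p)\<close> uniformly in \<open>n\<close> and \<open>t\<close>.\<close>

lemma node_sums:
  fixes c :: chebyshev_kind
  assumes n: "n > 0" and p: "1 < p" "p \<le> 2" and t: "0 \<le> t" "t \<le> pi"
  defines "N \<equiv> real n + freq_shift c"
  shows "(\<Sum>k=1..n. (1 + N * \<bar>sin ((t - cheb_angle c n k) / 2)\<bar>) powr (-p)) \<le> 2 * power_sum p"
    and "(\<Sum>k=1..n. (N * sin (cheb_angle c n k / 2)) powr (-p)) \<le> 4 * power_sum p"
    and "(\<Sum>k=1..n. (N * cos (cheb_angle c n k / 2)) powr (-p)) \<le> 4 * power_sum p"
proof -
  have N: "N > 0" using n freq_shift_bounds[of c] by (simp add: N_def)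
  have an: "N * cheb_angle c n k / pi = real k - node_shift c" for k
    using freq_times_angle[OF n, of c k] by (simp add: N_def)
  \<comment> \<open>The lower bounds on \<open>N sin (t\<^sub>k/2)\<close> and \<open>N cos (t\<^sub>k/2)\<close> are halves of integers; doubling costs at
    most \<open>2 powr p \<le> 4\<close>.\<close>
  have halve: "(g k :: real) powr (-p) \<le> 4 * (2 * g k) powr (-p)" if "g k > 0" for g and k :: nat
  proof -
    have "(2::real) powr p \<le> 2 powr 2" using p by (intro powr_mono) auto
    then have "2 powr p * (2 * g k) powr (-p) \<le> 4 * (2 * g k) powr (-p)" by (intro mult_right_mono) auto
    moreover have "2 powr p * (2 * g k) powr (-p) = g k powr (-p)"
      using that by (simp add: powr_mult powr_minus)
    ultimately show ?thesis by simp
  qed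
  have "(\<Sum>k=1..n. (1 + N * \<bar>sin ((t - cheb_angle c n k) / 2)\<bar>) powr (-p)) \<le>
     (\<Sum>k=1..n. (1 + \<bar>(N * t / pi + node_shift c) - real k\<bar>) powr (-p))"
  proof (intro sum_mono powr_mono2')
    fix k assume "k \<in> {1..n}"
    then have s: "0 < cheb_angle c n k" "cheb_angle c n k < pi" using cheb_angle_bounds by auto
    have "N * (\<bar>t - cheb_angle c n k\<bar> / pi) \<le> N * \<bar>sin ((t - cheb_angle c n k) / 2)\<bar>"
      using s t N by (intro mult_left_mono abs_sin_half_ge) auto
    also have "N * (\<bar>t - cheb_angle c n k\<bar> / pi) = \<bar>N * t / pi - N * cheb_angle c n k / pi\<bar>"
    proof -
      have "N * t / pi - N * cheb_angle c n k / pi = N / pi * (t - cheb_angle c n k)" by (simp add: field_simps)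
      then show ?thesis using N by (simp add: abs_mult)
    qed
    finally show "1 + \<bar>(N * t / pi + node_shift c) - real k\<bar> \<le> 1 + N * \<bar>sin ((t - cheb_angle c n k) / 2)\<bar>"
      unfolding an by simp
  qed (use p in auto)
  also have "\<dots> \<le> 2 * power_sum p" by (rule sum_shifted_le[OF p(1)])
  finally show "(\<Sum>k=1..n. (1 + N * \<bar>sin ((t - cheb_angle c n k) / 2)\<bar>) powr (-p)) \<le> 2 * power_sum p" .
  have lower: "real k \<le> 2 * (N * sin (cheb_angle c n k / 2))" "real (n + 1 - k) \<le> 2 * (N * cos (cheb_angle c n k / 2))"
    if k: "1 \<le> k" "k \<le> n" for k
  proof -
    let ?s = "cheb_angle c n k"
    note b = cheb_angle_bounds[OF k, of c, folded N_def]
    have "real k / 2 \<le> N * (2 * (?s / 2) / pi)" using b(1) N by (simp add: field_simps)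
    also have "\<dots> \<le> N * sin (?s / 2)" using b N by (intro mult_left_mono sin_ge_chord) auto
    finally show "real k \<le> 2 * (N * sin (?s / 2))" by simp
    have "real (n + 1 - k) / 2 \<le> N * (2 * ((pi - ?s) / 2) / pi)" using b(2) N by (simp add: field_simps)
    also have "\<dots> \<le> N * sin ((pi - ?s) / 2)" using b N by (intro mult_left_mono sin_ge_chord) auto
    also have "sin ((pi - ?s) / 2) = cos (?s / 2)" by (simp add: diff_divide_distrib sin_diff)
    finally show "real (n + 1 - k) \<le> 2 * (N * cos (?s / 2))" by simp
  qed
  have lower2: "1 + real (n - k) \<le> 2 * (N * cos (cheb_angle c n k / 2))" if k: "1 \<le> k" "k \<le> n" for k
    using lower(2)[OF k] k by (simp add: of_nat_diff)
  have positive: "N * sin (cheb_angle c n k / 2) > 0" "N * cos (cheb_angle c n k / 2) > 0"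
    if k: "1 \<le> k" "k \<le> n" for k
    using lower[OF k] k by linarith+
  have "(\<Sum>k=1..n. (N * sin (cheb_angle c n k / 2)) powr (-p)) \<le>
     (\<Sum>k=1..n. 4 * (2 * (N * sin (cheb_angle c n k / 2))) powr (-p))"
    using positive(1) by (intro sum_mono halve) auto
  also have "\<dots> \<le> 4 * power_sum p"
    unfolding sum_distrib_left[symmetric]
    by (intro mult_left_mono sum_powr_inj_le[OF p(1), where h = "\<lambda>k. k - 1"])
       (use lower(1) in \<open>auto simp: inj_on_def of_nat_diff\<close>)
  finally show "(\<Sum>k=1..n. (N * sin (cheb_angle c n k / 2)) powr (-p)) \<le> 4 * power_sum p" .
  have "(\<Sum>k=1..n. (N * cos (cheb_angle c n k / 2)) powr (-p)) \<le>
     (\<Sum>k=1..n. 4 * (2 * (N * cos (cheb_angle c n k / 2))) powr (-p))"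
    using positive(2) by (intro sum_mono halve) auto
  also have "\<dots> \<le> 4 * power_sum p"
    unfolding sum_distrib_left[symmetric]
    by (intro mult_left_mono sum_powr_inj_le[OF p(1), where h = "\<lambda>k. n - k"])
       (use lower2 in \<open>auto simp: inj_on_def\<close>)
  finally show "(\<Sum>k=1..n. (N * cos (cheb_angle c n k / 2)) powr (-p)) \<le> 4 * power_sum p" .
qed

section \<open>Boundedness in the weighted norm\<close>

text \<open>The exponents of \<open>sin (t/2)\<close> and \<open>cos (t/2)\<close> in \<open>u (cos t) / mode_denom c t\<close>.\<close>

definition left_exponent :: "chebyshev_kind \<Rightarrow> real \<Rightarrow> real" where
  "left_exponent c \<gamma> = 2 * \<gamma> - (if vanishes_at_0 c then 1 else 0)"

definition right_exponent :: "chebyshev_kind \<Rightarrow> real \<Rightarrow> real" where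
  "right_exponent c \<delta> = 2 * \<delta> - (if vanishes_at_pi c then 1 else 0)"

lemma jacobi_weight_pos: "-1 < x \<Longrightarrow> x < 1 \<Longrightarrow> jacobi_weight \<gamma> \<delta> x > 0"
  by (simp add: jacobi_weight_def jacobi_factor_def)

lemma jacobi_weight_nonneg: "jacobi_weight \<gamma> \<delta> x \<ge> 0"
  by (simp add: jacobi_weight_def jacobi_factor_def)

lemma continuous_on_jacobi_weight:
  assumes "0 \<le> \<gamma>" "0 \<le> \<delta>"
  shows "continuous_on {-1..1} (jacobi_weight \<gamma> \<delta>)"
proof -
  have "continuous_on {-1..1} (\<lambda>x::real. jacobi_factor (1 - x) \<gamma>)"
    unfolding jacobi_factor_def using assms by (cases "\<gamma> = 0") (auto intro!: continuous_intros continuous_on_powr')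
  moreover have "continuous_on {-1..1} (\<lambda>x::real. jacobi_factor (1 + x) \<delta>)"
    unfolding jacobi_factor_def using assms by (cases "\<delta> = 0") (auto intro!: continuous_intros continuous_on_powr')
  ultimately show ?thesis unfolding jacobi_weight_def by (intro continuous_on_mult)
qed

lemma jacobi_weight_cos:
  assumes "0 < t" "t < pi"
  shows "jacobi_weight \<gamma> \<delta> (cos t) = 2 powr (\<gamma> + \<delta>) * (sin (t/2) powr (2 * \<gamma>) * cos (t/2) powr (2 * \<delta>))"
proof -
  have a: "sin (t/2) > 0" "cos (t/2) > 0" using assms by (auto intro!: sin_gt_zero cos_gt_zero)
  have "1 - cos t = 2 * sin (t/2) powr 2" "1 + cos t = 2 * cos (t/2) powr 2"
    using cos_double_half[of t] a by simp_all
  moreover have "(y\<^sup>2) powr g = y powr (2 * g)" if "y > 0" for y g :: real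
    using that powr_powr[of y 2 g] by simp
  moreover have "jacobi_factor y g = y powr g" if "y > 0" for y g using that by (simp add: jacobi_factor_def)
  ultimately show ?thesis
    using a by (simp add: jacobi_weight_def powr_mult powr_powr powr_add)
qed

lemma weight_ratio:
  assumes t: "0 < t" "t < pi" and s: "0 < s" "s < pi"
  shows "jacobi_weight \<gamma> \<delta> (cos t) / jacobi_weight \<gamma> \<delta> (cos s) * (mode_denom c s / mode_denom c t) =
    (sin (t/2) / sin (s/2)) powr left_exponent c \<gamma> * (cos (t/2) / cos (s/2)) powr right_exponent c \<delta>"
proof -
  define a b a' b' where ab: "a = sin (t/2)" "b = cos (t/2)" "a' = sin (s/2)" "b' = cos (s/2)"
  have p: "a > 0" "b > 0" "a' > 0" "b' > 0" using t s by (auto simp: ab intro!: sin_gt_zero cos_gt_zero)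
  have w: "jacobi_weight \<gamma> \<delta> (cos t) / jacobi_weight \<gamma> \<delta> (cos s) = (a / a') powr (2 * \<gamma>) * (b / b') powr (2 * \<delta>)"
    unfolding jacobi_weight_cos[OF t] jacobi_weight_cos[OF s] ab[symmetric] using p by (simp add: powr_divide)
  have md: "mode_denom c s / mode_denom c t =
     (if vanishes_at_0 c then (a / a') powr (-1) else 1) * (if vanishes_at_pi c then (b / b') powr (-1) else 1)"
    using sin_double[of "t/2"] sin_double[of "s/2"] p
    by (cases c) (auto simp: vanishes_at_0_def vanishes_at_pi_def ab[symmetric] powr_minus)
  show ?thesis unfolding w md ab[symmetric] left_exponent_def right_exponent_def
    using p by (cases "vanishes_at_0 c"; cases "vanishes_at_pi c") (simp_all add: powr_diff powr_minus)
qed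

text \<open>In terms of these exponents, the bounds on \<open>\<gamma>\<close> and \<open>\<delta>\<close> that are imposed for the four kinds become
  this one condition.\<close>

definition exponents_ok :: "chebyshev_kind \<Rightarrow> real \<Rightarrow> real \<Rightarrow> bool" where
  "exponents_ok c \<gamma> \<delta> \<longleftrightarrow> 0 \<le> \<gamma> \<and> 0 \<le> \<delta> \<and>
     -1 < left_exponent c \<gamma> \<and> left_exponent c \<gamma> \<le> 2 \<and>
     -1 < right_exponent c \<delta> \<and> right_exponent c \<delta> \<le> 2 \<and>
     \<bar>left_exponent c \<gamma> - right_exponent c \<delta>\<bar> \<le> 2"

text \<open>If \<open>t\<close> is closer to \<open>0\<close> than the node, then the ratio of the sines is at most \<open>1\<close> and that of the
  cosines at least \<open>1\<close>; otherwise their roles are exchanged. Adding the two resulting bounds covers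
  both cases.\<close>

lemma weighted_fundamental_bound:
  assumes ex: "exponents_ok c \<gamma> \<delta>"
    and m: "0 < m" "m < n" and C0: "real n \<le> C0 * real m" "C0 > 1"
    and t: "0 < t" "t < pi" and k: "1 \<le> k" "k \<le> n"
  defines "N \<equiv> real n + freq_shift c" and "s \<equiv> cheb_angle c n k"
    and "p \<equiv> 2 - max 0 (- left_exponent c \<gamma>)" and "q \<equiv> 2 - max 0 (- right_exponent c \<delta>)"
  shows "\<bar>vp_fundamental c n m k (cos t)\<bar> * jacobi_weight \<gamma> \<delta> (cos t) / jacobi_weight \<gamma> \<delta> (cheb_node c n k) \<le>
    256 * C0 * ((1 + N * \<bar>sin ((t - s) / 2)\<bar>) powr (-p) + (N * cos (s/2)) powr (-p) +
                ((1 + N * \<bar>sin ((t - s) / 2)\<bar>) powr (-q) + (N * sin (s/2)) powr (-q)))"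
proof -
  define \<alpha> \<beta> where ab: "\<alpha> = left_exponent c \<gamma>" "\<beta> = right_exponent c \<delta>"
  define a b a' b' d where abd: "a = sin (t/2)" "b = cos (t/2)" "a' = sin (s/2)" "b' = cos (s/2)" "d = \<bar>sin ((t - s) / 2)\<bar>"
  define R where "R = (a / a') powr \<alpha> * (b / b') powr \<beta>"
  define K where "K = vp_kernel c n m t s"
  define E where "E = (1 + N * d) powr (-p) + (N * b') powr (-p) + ((1 + N * d) powr (-q) + (N * a') powr (-q))"
  have s: "0 < s" "s < pi" using cheb_angle_bounds[OF k] by (auto simp: s_def)
  have N: "N > 0" using m freq_shift_bounds[of c] by (simp add: N_def)
  have pos: "a > 0" "b > 0" "a' > 0" "b' > 0" "d \<ge> 0"
    using t s by (auto simp: abd intro!: sin_gt_zero cos_gt_zero)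
  have ex': "-1 < \<alpha>" "\<alpha> \<le> 2" "-1 < \<beta>" "\<beta> \<le> 2" "\<beta> - \<alpha> \<le> 2" "\<alpha> - \<beta> \<le> 2"
    using ex by (auto simp: exponents_ok_def ab)
  have van: "\<alpha> < 0 \<Longrightarrow> vanishes_at_0 c" "\<beta> < 0 \<Longrightarrow> vanishes_at_pi c"
    using ex by (auto simp: exponents_ok_def ab left_exponent_def right_exponent_def split: if_splits)
  \<comment> \<open>Addition theorems: half-angle sines and cosines at \<open>t\<close> and \<open>s\<close> differ by at most \<open>d\<close>.\<close>
  have ts: "t/2 = s/2 + (t - s)/2" "s/2 = t/2 - (t - s)/2" by (simp_all add: field_simps)
  have small: "\<bar>x * sin ((t - s)/2)\<bar> \<le> d" "\<bar>y * cos ((t - s)/2)\<bar> \<le> \<bar>y\<bar>" if "\<bar>x\<bar> \<le> 1" for x y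
    using that by (auto simp: abs_mult abd mult_left_le_one_le mult_left_le)
  have near: "a' \<le> a + d" "b \<le> b' + d" "a \<le> a' + d" "b' \<le> b + d"
  proof -
    have "a' = a * cos ((t - s)/2) - b * sin ((t - s)/2)" unfolding abd by (subst (1) ts(2)) (simp only: sin_diff)
    then show "a' \<le> a + d" using small(1)[of b] small(2)[of b a] pos by (simp add: abd)
    have "b = b' * cos ((t - s)/2) - a' * sin ((t - s)/2)" unfolding abd by (subst (1) ts(1)) (simp only: cos_add)
    then show "b \<le> b' + d" using small(1)[of a'] small(2)[of a' b'] pos by (simp add: abd)
    have "a = a' * cos ((t - s)/2) + b' * sin ((t - s)/2)" unfolding abd by (subst (1) ts(1)) (simp only: sin_add)
    then show "a \<le> a' + d" using small(1)[of b'] small(2)[of b' a'] pos by (simp add: abd)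
    have "b' = b * cos ((t - s)/2) + a * sin ((t - s)/2)" unfolding abd by (subst (1) ts(2)) (simp only: cos_diff)
    then show "b' \<le> b + d" using small(1)[of a] small(2)[of a b] pos by (simp add: abd)
  qed
  have kb: "\<bar>K\<bar> \<le> 64 * C0 * N * (H / (1 + N * d)\<^sup>2)"
    if "H = 1 \<or> vanishes_at_0 c \<and> H = min 1 (N * a) \<or> vanishes_at_pi c \<and> H = min 1 (N * b)" for H
    using vp_kernel_gain[OF m C0 _ _ k, of t H c] t that by (simp add: K_def N_def s_def abd)
  have R0: "R \<ge> 0" by (simp add: R_def)
  have key: "R * \<bar>K\<bar> \<le> 256 * C0 * N * E"
  proof (cases "a \<le> a'")
    case True
    have "b' \<le> b" using True t s by (simp add: abd cos_mono_le_eq sin_mono_le_eq)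
    define H where "H = (if \<alpha> < 0 then min 1 (N * a) else 1)"
    have "R * (H / (1 + N * d)\<^sup>2) \<le> 4 * ((1 + N * d) powr (-p) + (N * b') powr (-p))"
      using ratio_kernel_bound[of a b a' b' N d \<alpha> \<beta>] pos N True \<open>b' \<le> b\<close> near ex'
      by (simp add: R_def H_def p_def ab)
    also have "\<dots> \<le> 4 * E" by (simp add: E_def)
    finally have 1: "R * (H / (1 + N * d)\<^sup>2) \<le> 4 * E" .
    have "R * \<bar>K\<bar> \<le> R * (64 * C0 * N * (H / (1 + N * d)\<^sup>2))"
      using R0 van(1) by (intro mult_left_mono kb) (auto simp: H_def)
    also have "\<dots> = 64 * C0 * N * (R * (H / (1 + N * d)\<^sup>2))" by simp
    also have "\<dots> \<le> 64 * C0 * N * (4 * E)" using 1 C0 N by (intro mult_left_mono) auto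
    finally show ?thesis by simp
  next
    case False
    have "b \<le> b'" using False t s by (simp add: abd cos_mono_le_eq sin_mono_le_eq)
    define H where "H = (if \<beta> < 0 then min 1 (N * b) else 1)"
    have "R * (H / (1 + N * d)\<^sup>2) \<le> 4 * ((1 + N * d) powr (-q) + (N * a') powr (-q))"
      using ratio_kernel_bound[of b a b' a' N d \<beta> \<alpha>] pos N False \<open>b \<le> b'\<close> near ex'
      by (simp add: R_def H_def q_def ab mult.commute)
    also have "\<dots> \<le> 4 * E" by (simp add: E_def)
    finally have 1: "R * (H / (1 + N * d)\<^sup>2) \<le> 4 * E" .
    have "R * \<bar>K\<bar> \<le> R * (64 * C0 * N * (H / (1 + N * d)\<^sup>2))"
      using R0 van(2) by (intro mult_left_mono kb) (auto simp: H_def)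
    also have "\<dots> = 64 * C0 * N * (R * (H / (1 + N * d)\<^sup>2))" by simp
    also have "\<dots> \<le> 64 * C0 * N * (4 * E)" using 1 C0 N by (intro mult_left_mono) auto
    finally show ?thesis by simp
  qed
  have "mode_denom c s > 0" "mode_denom c t > 0" using mode_denom_pos s t by auto
  then have "\<bar>vp_fundamental c n m k (cos t)\<bar> = mode_denom c s / mode_denom c t * \<bar>K\<bar> / N"
    using vp_fundamental_cos[OF k m(1) t, of c] N by (simp add: K_def s_def N_def abs_mult)
  then have "\<bar>vp_fundamental c n m k (cos t)\<bar> * jacobi_weight \<gamma> \<delta> (cos t) / jacobi_weight \<gamma> \<delta> (cheb_node c n k) =
    (jacobi_weight \<gamma> \<delta> (cos t) / jacobi_weight \<gamma> \<delta> (cos s) * (mode_denom c s / mode_denom c t)) * \<bar>K\<bar> / N"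
    by (simp add: cheb_node_def s_def mult_ac)
  also have "\<dots> = R * \<bar>K\<bar> / N" unfolding weight_ratio[OF t s] by (simp add: R_def ab abd)
  also have "\<dots> \<le> 256 * C0 * N * E / N" using key N by (intro divide_right_mono) auto
  also have "\<dots> = 256 * C0 * E" using N by simp
  finally show ?thesis unfolding E_def abd .
qed

definition vp_const :: "chebyshev_kind \<Rightarrow> real \<Rightarrow> real \<Rightarrow> real \<Rightarrow> real" where
  "vp_const c \<gamma> \<delta> C0 = 256 * C0 * (6 * power_sum (2 - max 0 (- left_exponent c \<gamma>)) +
                                    6 * power_sum (2 - max 0 (- right_exponent c \<delta>)))"

text \<open>The left-hand side is the weighted Lebesgue function, whose supremum over \<open>x\<close> is the norm of the
  operator on the weighted space.\<close>

lemma weighted_lebesgue_bound: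
  assumes ex: "exponents_ok c \<gamma> \<delta>"
    and m: "0 < m" "m < n" and C0: "real n \<le> C0 * real m" "C0 > 1"
    and x: "-1 < x" "x < 1"
  shows "(\<Sum>k=1..n. \<bar>vp_fundamental c n m k x\<bar> * jacobi_weight \<gamma> \<delta> x / jacobi_weight \<gamma> \<delta> (cheb_node c n k)) \<le>
    vp_const c \<gamma> \<delta> C0"
proof -
  define t where "t = arccos x"
  have t: "0 < t" "t < pi" using x arccos_lt_bounded[of x] by (auto simp: t_def)
  have xt: "x = cos t" using x by (simp add: t_def)
  define p q where "p = 2 - max 0 (- left_exponent c \<gamma>)" and "q = 2 - max 0 (- right_exponent c \<delta>)"
  have pq: "1 < p" "p \<le> 2" "1 < q" "q \<le> 2" using ex by (auto simp: exponents_ok_def p_def q_def)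
  have n: "n > 0" using m by simp
  have t': "0 \<le> t" "t \<le> pi" using t by auto
  define N where "N = real n + freq_shift c"
  note sp = node_sums[OF n pq(1,2) t', of c, folded N_def]
  note sq = node_sums[OF n pq(3,4) t', of c, folded N_def]
  have "(\<Sum>k=1..n. \<bar>vp_fundamental c n m k x\<bar> * jacobi_weight \<gamma> \<delta> x / jacobi_weight \<gamma> \<delta> (cheb_node c n k)) \<le>
    (\<Sum>k=1..n. 256 * C0 * ((1 + N * \<bar>sin ((t - cheb_angle c n k) / 2)\<bar>) powr (-p) + (N * cos (cheb_angle c n k/2)) powr (-p) +
                ((1 + N * \<bar>sin ((t - cheb_angle c n k) / 2)\<bar>) powr (-q) + (N * sin (cheb_angle c n k/2)) powr (-q))))"
    unfolding xt p_def q_def N_def by (intro sum_mono weighted_fundamental_bound[OF ex m C0 t]) auto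
  also have "\<dots> \<le> 256 * C0 * (6 * power_sum p + 6 * power_sum q)"
    unfolding sum_distrib_left[symmetric] sum.distrib using sp sq C0 by (intro mult_left_mono) auto
  finally show ?thesis by (simp add: vp_const_def p_def q_def)
qed

text \<open>Inside the interval this is the bound on the weighted Lebesgue function. The weighted image is a
  polynomial times a continuous weight, so the bound extends to the endpoints.\<close>

lemma vp_operator_weighted_bound:
  assumes ex: "exponents_ok c \<gamma> \<delta>"
    and m: "0 < m" "m < n" and C0: "real n \<le> C0 * real m" "C0 > 1"
    and M: "\<And>x. -1 < x \<Longrightarrow> x < 1 \<Longrightarrow> \<bar>g x\<bar> * jacobi_weight \<gamma> \<delta> x \<le> M"
    and x: "x \<in> {-1..1}"
  shows "\<bar>vp_operator c n m g x\<bar> * jacobi_weight \<gamma> \<delta> x \<le> vp_const c \<gamma> \<delta> C0 * M"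
proof -
  let ?u = "jacobi_weight \<gamma> \<delta>"
  have M0: "M \<ge> 0" using M[of 0] jacobi_weight_pos[of 0 \<gamma> \<delta>] 
    by (meson abs_ge_zero mult_nonneg_nonneg order.trans jacobi_weight_nonneg less_numeral_extra(1) neg_less_0_iff_less)
  have inside: "\<bar>vp_operator c n m g y\<bar> * ?u y \<le> vp_const c \<gamma> \<delta> C0 * M" if y: "-1 < y" "y < 1" for y
  proof -
    have "\<bar>vp_operator c n m g y\<bar> * ?u y \<le> (\<Sum>k=1..n. \<bar>g (cheb_node c n k) * vp_fundamental c n m k y\<bar>) * ?u y"
      unfolding vp_operator_def by (intro mult_right_mono sum_abs jacobi_weight_nonneg)
    also have "\<dots> \<le> (\<Sum>k=1..n. M * (\<bar>vp_fundamental c n m k y\<bar> * ?u y / ?u (cheb_node c n k)))"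
      unfolding sum_distrib_right
    proof (intro sum_mono)
      fix k assume "k \<in> {1..n}"
      then have s: "0 < cheb_angle c n k" "cheb_angle c n k < pi" using cheb_angle_bounds by auto
      have "cos pi < cos (cheb_angle c n k)" "cos (cheb_angle c n k) < cos 0"
        using s by (intro cos_monotone_0_pi; simp)+
      then have node: "-1 < cheb_node c n k" "cheb_node c n k < 1" by (auto simp: cheb_node_def)
      have u: "?u (cheb_node c n k) > 0" by (rule jacobi_weight_pos[OF node])
      have "\<bar>g (cheb_node c n k) * vp_fundamental c n m k y\<bar> * ?u y =
        (\<bar>g (cheb_node c n k)\<bar> * ?u (cheb_node c n k)) * (\<bar>vp_fundamental c n m k y\<bar> * ?u y / ?u (cheb_node c n k))"
        using u by (simp add: abs_mult)
      also have "\<dots> \<le> M * (\<bar>vp_fundamental c n m k y\<bar> * ?u y / ?u (cheb_node c n k))"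
        using M[OF node] jacobi_weight_nonneg by (intro mult_right_mono) auto
      finally show "\<bar>g (cheb_node c n k) * vp_fundamental c n m k y\<bar> * ?u y \<le> \<dots>" .
    qed
    also have "\<dots> \<le> M * vp_const c \<gamma> \<delta> C0"
      unfolding sum_distrib_left[symmetric]
      using M0 by (intro mult_left_mono weighted_lebesgue_bound[OF ex m C0 y]) auto
    finally show ?thesis by (simp add: mult.commute)
  qed
  obtain Q where Q: "\<And>y. vp_operator c n m g y = poly Q y" using vp_operator_poly by metis
  have cl: "closure {-1<..<1::real} = {-1..1}" by (rule closure_greaterThanLessThan) simp
  have "continuous_on (closure {-1<..<1}) (\<lambda>y. \<bar>vp_operator c n m g y\<bar> * ?u y)"
    unfolding cl Q using ex
    by (intro continuous_intros continuous_on_jacobi_weight) (auto simp: exponents_ok_def)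
  then show ?thesis
    by (rule continuous_le_on_closure) (use x inside cl in auto)
qed

section \<open>Quasi-best approximation\<close>

lemma vp_operator_diff:
  "vp_operator c n m (\<lambda>y. f y - g y) x = vp_operator c n m f x - vp_operator c n m g x"
  by (simp add: vp_operator_def left_diff_distrib sum_subtractf)

lemma sup_norm_leI: "(\<And>x. x \<in> {-1..1} \<Longrightarrow> \<bar>g x\<bar> \<le> M) \<Longrightarrow> sup_norm g \<le> ennreal M"
  unfolding sup_norm_def by (intro SUP_least ennreal_leI)

lemma sup_norm_geD: "sup_norm g \<le> ennreal M \<Longrightarrow> M \<ge> 0 \<Longrightarrow> x \<in> {-1..1} \<Longrightarrow> \<bar>g x\<bar> \<le> M"
  unfolding sup_norm_def by (auto simp: SUP_le_iff)

lemma power_sum_nonneg: "p > 1 \<Longrightarrow> power_sum p \<ge> 0"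
  using power_sum_le[of p "{}"] by simp

theorem corollary3p2:
  fixes c :: chebyshev_kind and \<gamma> \<delta> C0 :: real and u :: "real \<Rightarrow> real"
  defines "u \<equiv> jacobi_weight \<gamma> \<delta>"
  assumes "c = Cheb1 \<Longrightarrow> 0 \<le> \<gamma> \<and> \<gamma> \<le> 1 \<and> 0 \<le> \<delta> \<and> \<delta> \<le> 1"
    and "c = Cheb2 \<Longrightarrow> 0 < \<gamma> \<and> \<gamma> \<le> 3/2 \<and> 0 < \<delta> \<and> \<delta> \<le> 3/2 \<and> -1 \<le> \<gamma> - \<delta> \<and> \<gamma> - \<delta> \<le> 1"
    and "c = Cheb3 \<Longrightarrow> 0 \<le> \<gamma> \<and> \<gamma> \<le> 1 \<and> 0 < \<delta> \<and> \<delta> \<le> 3/2 \<and> \<gamma> - \<delta> \<le> 1/2"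
    and "c = Cheb4 \<Longrightarrow> 0 < \<gamma> \<and> \<gamma> \<le> 3/2 \<and> 0 \<le> \<delta> \<and> \<delta> \<le> 1 \<and> \<gamma> - \<delta> \<ge> -1/2"
    and "C0 > 1"
  shows "\<exists>C>0. \<forall>n m :: nat. \<forall>f :: real \<Rightarrow> real.
           0 < m \<and> m < n \<and> real n \<le> C0 * real m \<and> admissible u f \<longrightarrow>
             best_approx_error u (n + m - 1) f \<le> sup_norm (\<lambda>x. (f x - vp_operator c n m f x) * u x) \<and>
             sup_norm (\<lambda>x. (f x - vp_operator c n m f x) * u x) \<le> ennreal C * best_approx_error u (n - m) f"
proof -
  have ex: "exponents_ok c \<gamma> \<delta>"
    using assms(2-5) unfolding exponents_ok_def left_exponent_def right_exponent_def vanishes_at_0_def vanishes_at_pi_def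
    by (cases c) auto
  define L where "L = vp_const c \<gamma> \<delta> C0"
  have L: "L \<ge> 0" unfolding L_def vp_const_def
    using ex \<open>C0 > 1\<close> by (intro mult_nonneg_nonneg add_nonneg_nonneg power_sum_nonneg) (auto simp: exponents_ok_def)
  show ?thesis
  proof (intro exI[of _ "1 + L"] conjI allI impI)
    show "0 < 1 + L" using L by simp
    fix n m :: nat and f :: "real \<Rightarrow> real"
    assume a: "0 < m \<and> m < n \<and> real n \<le> C0 * real m \<and> admissible u f"
    then have m: "0 < m" "m < n" "real n \<le> C0 * real m" by auto
    let ?S = "sup_norm (\<lambda>x. (f x - vp_operator c n m f x) * u x)"
    obtain Q where Q: "degree Q \<le> n + m - 1" "\<And>x. vp_operator c n m f x = poly Q x"
      using vp_operator_poly by metis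
    show "best_approx_error u (n + m - 1) f \<le> ?S"
      unfolding best_approx_error_def using Q by (intro INF_lower2[of Q]) auto
    have bound: "?S \<le> ennreal (1 + L) * sup_norm (\<lambda>x. (f x - poly P x) * u x)" if P: "degree P \<le> n - m" for P
    proof (cases "sup_norm (\<lambda>x. (f x - poly P x) * u x)")
      case (real M)
      have fP: "\<bar>f x - poly P x\<bar> * u x \<le> M" if "x \<in> {-1..1}" for x
        using sup_norm_geD[of "\<lambda>x. (f x - poly P x) * u x" M x] real that
        by (simp add: abs_mult u_def jacobi_weight_nonneg)
      have "\<bar>(f x - vp_operator c n m f x) * u x\<bar> \<le> (1 + L) * M" if x: "x \<in> {-1..1}" for x
      proof -
        have V: "\<bar>vp_operator c n m (\<lambda>y. f y - poly P y) x\<bar> * u x \<le> L * M"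
          unfolding L_def u_def by (rule vp_operator_weighted_bound[OF ex m \<open>C0 > 1\<close> _ x]) (use fP in \<open>auto simp: u_def\<close>)
        have "f x - vp_operator c n m f x = (f x - poly P x) - vp_operator c n m (\<lambda>y. f y - poly P y) x"
          using vp_operator_reproduces[OF m(1,2) P, of c x] by (simp add: vp_operator_diff)
        then have "\<bar>f x - vp_operator c n m f x\<bar> \<le> \<bar>f x - poly P x\<bar> + \<bar>vp_operator c n m (\<lambda>y. f y - poly P y) x\<bar>"
          by linarith
        then have "\<bar>f x - vp_operator c n m f x\<bar> * u x \<le> (\<bar>f x - poly P x\<bar> + \<bar>vp_operator c n m (\<lambda>y. f y - poly P y) x\<bar>) * u x"
          by (intro mult_right_mono) (auto simp: u_def jacobi_weight_nonneg)
        also have "\<dots> \<le> M + L * M" unfolding distrib_right using fP[OF x] V by linarith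
        finally show ?thesis by (simp add: abs_mult u_def jacobi_weight_nonneg distrib_right)
      qed
      then have "?S \<le> ennreal ((1 + L) * M)" by (rule sup_norm_leI)
      then show ?thesis using real L by (simp add: ennreal_mult)
    next
      case top
      then show ?thesis using L by (simp add: ennreal_mult_top)
    qed
    have pos: "0 < ennreal (1 + L)" using L by (simp del: ennreal_plus)
    have "?S / ennreal (1 + L) \<le> best_approx_error u (n - m) f"
      unfolding best_approx_error_def
    proof (rule INF_greatest)
      fix P :: "real poly" assume "P \<in> {P. degree P \<le> n - m}"
      then show "?S / ennreal (1 + L) \<le> sup_norm (\<lambda>x. (f x - poly P x) * u x)"
        using bound[of P] by (intro divide_le_posI_ennreal pos) (simp add: mult.commute)
    qed
    then have "?S / ennreal (1 + L) * ennreal (1 + L) \<le> best_approx_error u (n - m) f * ennreal (1 + L)"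
      by (intro mult_right_mono) auto
    moreover have "?S / ennreal (1 + L) * ennreal (1 + L) = ?S"
      using L by (simp add: ennreal_divide_times)
    ultimately show "?S \<le> ennreal (1 + L) * best_approx_error u (n - m) f"
      by (simp add: mult.commute)
  qed
qed

end
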